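(* Let $n\ge 2$. The Voronoi cell $V(\mathbf 0)$ of the lattice $A_n$ is the disjoint union of $n+1$ congruent hyper-rhombi, and each of these hyper-rhombi is in turn composed of $n!$ congruent simplices. Specifically, the union of the $n!$ images of $\sigma_0$ under the permutations of the first $n$ components forms the $n$-dimensional hyper-rhombus $\Diamond_{n+1}$: $$\Diamond_{n+1}=\bigsqcup_{Q\in G_1}Q\sigma_0,\qquad G_1:=\left\{\begin{bmatrix}\Pi&0\\0&1\end{bmatrix}:\Pi\in S_n\right\},$$ and the union of the $n+1$ images of $\Diamond_{n+1}$ under the circular shifts in $C_{n+1}$ forms $V(\mathbf 0)$: $$V(\mathbf 0)=\bigsqcup_{\Gamma\in C_{n+1}}\Gamma\,\Diamond_{n+1}=\bigsqcup_{j=1}^{n+1}\Diamond_j,\qquad\text{where } \Diamond_j=\Gamma_{n+1,\,j\bmod (n+1)}\,\Diamond_{n+1}.$$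
   Context: Let $\mathbf 1=(1,\dots,1)^T\in\mathbb R^{n+1}$, $H=\{x\in\mathbb R^{n+1}:x\cdot\mathbf 1=0\}$, and let $e_i$ be the standard unit vectors. The lattice $A_n$ is $\mathbb Z^{n+1}\cap H$. Its Voronoi cell at the origin, taken inside $H$, is $V(\mathbf 0)=\{x\in H:\|x\|\le\|x-q\|\text{ for all }q\in A_n\}$. Let $\xi_i=e_i-\frac1{n+1}\mathbf 1$ for $1\le i\le n+1$ (the orthogonal projection of $e_i$ onto $H$). For $1\le j\le n+1$ put $\Diamond_j=\{\sum_{i\ne j}t_i\xi_i:0\le t_i\le1\}$, the $n$-dimensional parallelepiped spanned by all $\xi_i$ with $i\neq j$. Let $v_j=\sum_{i=1}^j\xi_i$ for $0\le j\le n$ (so $v_0=\mathbf 0$), and let $\sigma_0$ be the convex hull of $\{v_0,\dots,v_n\}$, an $n$-simplex in $H$. $S_n$ denotes the group of $n\times n$ permutation matrices. For $0\le j\le m-1$, $\Gamma_{m,j}$ is the $m\times m$ circular shift matrix obtained by circularly shifting the rows of the identity matrix downward by $j$, i.e. $\Gamma_{m,j}e_i=e_{i+j}$ with indices taken modulo $m$ in $\{1,\dots,m\}$; $C_m=\{\Gamma_{m,j}:0\le j\le m-1\}$. An $m$-dimensional hyper-rhombus is defined recursively: for $m=2$ it is a rhombus; for $m\ge3$ it is a parallelepiped all of whose $(m-1)$-dimensional faces are congruent $(m-1)$-dimensional hyper-rhombi. Congruent means related by an isometry. "Disjoint union" $\bigsqcup$ (and "composed of") for closed polytopes of the same dimension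 means that the union is as stated and the pieces have pairwise disjoint relative interiors. *)

theory Defs
  imports "HOL-Analysis.Analysis"
begin

definition congruent_sets :: "'a::euclidean_space set \<Rightarrow> 'a set \<Rightarrow> bool" where
  "congruent_sets S T \<longleftrightarrow> (\<exists>f. (\<forall>x y. dist (f x) (f y) = dist x y) \<and> f ` S = T)"

text \<open>Pieces are indexed, so distinct indices must give pieces with disjoint relative interiors.\<close>

definition disjoint_union_of :: "'i set \<Rightarrow> ('i \<Rightarrow> 'a::euclidean_space set) \<Rightarrow> 'a set \<Rightarrow> bool" where
  "disjoint_union_of I P S \<longleftrightarrow>
     (\<forall>i\<in>I. polytope (P i) \<and> aff_dim (P i) = aff_dim S) \<and>
     S = (\<Union>i\<in>I. P i) \<and>
     (\<forall>i\<in>I. \<forall>j\<in>I. i \<noteq> j \<longrightarrow> rel_interior (P i) \<inter> rel_interior (P j) = {})"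

definition composed_of_congruent :: "nat \<Rightarrow> 'a::euclidean_space set set \<Rightarrow> 'a set \<Rightarrow> bool" where
  "composed_of_congruent k \<P> S \<longleftrightarrow>
     finite \<P> \<and> card \<P> = k \<and>
     (\<forall>P\<in>\<P>. \<forall>Q\<in>\<P>. congruent_sets P Q) \<and>
     disjoint_union_of \<P> (\<lambda>P. P) S"

definition parallelepiped :: "nat \<Rightarrow> 'a::euclidean_space set \<Rightarrow> bool" where
  "parallelepiped m S \<longleftrightarrow>
     (\<exists>p B. independent B \<and> card B = m \<and>
        S = {p + (\<Sum>b\<in>B. t b *\<^sub>R b) | t. \<forall>b\<in>B. 0 \<le> t b \<and> t b \<le> 1})"

definition rhombus :: "'a::euclidean_space set \<Rightarrow> bool" where
  "rhombus S \<longleftrightarrow>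
     (\<exists>p u v. u \<noteq> v \<and> independent {u, v} \<and> norm u = norm v \<and>
        S = {p + s *\<^sub>R u + t *\<^sub>R v | s t. 0 \<le> s \<and> s \<le> 1 \<and> 0 \<le> t \<and> t \<le> 1})"

text \<open>The notion starts in dimension 2; it is false by convention in dimensions 0 and 1.\<close>

primrec hyper_rhombus :: "nat \<Rightarrow> 'a::euclidean_space set \<Rightarrow> bool" where
  "hyper_rhombus 0 S \<longleftrightarrow> False"
| "hyper_rhombus (Suc m) S \<longleftrightarrow>
     (if m = 0 then False
      else if m = 1 then rhombus S
      else parallelepiped (Suc m) S \<and>
        (\<forall>F. F face_of S \<and> aff_dim F = int m \<longrightarrow> hyper_rhombus m F) \<and>
        (\<forall>F G. F face_of S \<and> aff_dim F = int m \<and> G face_of S \<and> aff_dim G = int m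
           \<longrightarrow> congruent_sets F G))"

definition hyperplane_H :: "(real ^ 'm) set" where
  "hyperplane_H = {x. x \<bullet> 1 = 0}"

definition lattice_A :: "(real ^ 'm) set" where
  "lattice_A = {x. \<forall>i. x $ i \<in> \<int>} \<inter> hyperplane_H"

definition voronoi_cell_0 :: "(real ^ 'm) set" where
  "voronoi_cell_0 = {x \<in> hyperplane_H. \<forall>q\<in>lattice_A. norm x \<le> norm (x - q)}"

text \<open>
  The coordinates of \<open>real ^ 'm\<close> are numbered by a function \<open>pos\<close>, meant to be a bijection
  from the index type onto \<open>{1..n+1}\<close>.
\<close>

definition unit_vec :: "('m \<Rightarrow> nat) \<Rightarrow> nat \<Rightarrow> real ^ 'm" where
  "unit_vec pos i = (\<chi> r. of_bool (pos r = i))"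

definition xi :: "('m \<Rightarrow> nat) \<Rightarrow> nat \<Rightarrow> nat \<Rightarrow> real ^ 'm" where
  "xi pos n i = unit_vec pos i - (1 / (real n + 1)) *\<^sub>R 1"

definition diamond :: "('m::finite \<Rightarrow> nat) \<Rightarrow> nat \<Rightarrow> nat \<Rightarrow> (real ^ 'm) set" where
  "diamond pos n j =
     {(\<Sum>i\<in>{1..n+1} - {j}. t i *\<^sub>R xi pos n i) | t. \<forall>i\<in>{1..n+1} - {j}. 0 \<le> t i \<and> t i \<le> 1}"

definition vertex_v :: "('m::finite \<Rightarrow> nat) \<Rightarrow> nat \<Rightarrow> nat \<Rightarrow> real ^ 'm" where
  "vertex_v pos n j = (\<Sum>i\<in>{1..j}. xi pos n i)"

definition sigma0 :: "('m::finite \<Rightarrow> nat) \<Rightarrow> nat \<Rightarrow> (real ^ 'm) set" where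
  "sigma0 pos n = convex hull (vertex_v pos n ` {0..n})"

text \<open>The \<open>n \<times> n\<close> permutation matrices, as functions of row and column number in \<open>{1..n}\<close>.\<close>

definition perm_matrices :: "nat \<Rightarrow> (nat \<Rightarrow> nat \<Rightarrow> real) set" where
  "perm_matrices n = {(\<lambda>i j. of_bool (i = \<pi> j)) | \<pi>. \<pi> permutes {1..n}}"

definition block_matrix :: "('m \<Rightarrow> nat) \<Rightarrow> nat \<Rightarrow> (nat \<Rightarrow> nat \<Rightarrow> real) \<Rightarrow> real ^ 'm ^ 'm" where
  "block_matrix pos n A =
     (\<chi> r c. if pos r \<le> n \<and> pos c \<le> n then A (pos r) (pos c) else of_bool (pos r = pos c))"

definition G1 :: "('m \<Rightarrow> nat) \<Rightarrow> nat \<Rightarrow> (real ^ 'm ^ 'm) set" where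
  "G1 pos n = block_matrix pos n ` perm_matrices n"

text \<open>Column \<open>c\<close> has its 1 in row \<open>c + j\<close>, row numbers being read modulo \<open>m\<close> in \<open>{1..m}\<close>.\<close>

definition circ_shift :: "('m \<Rightarrow> nat) \<Rightarrow> nat \<Rightarrow> nat \<Rightarrow> real ^ 'm ^ 'm" where
  "circ_shift pos m j = (\<chi> r c. of_bool (pos r mod m = (pos c + j) mod m))"

definition circ_shifts :: "('m \<Rightarrow> nat) \<Rightarrow> nat \<Rightarrow> (real ^ 'm ^ 'm) set" where
  "circ_shifts pos m = circ_shift pos m ` {0..<m}"

end

theory Submission
  imports Defs
begin

text \<open>
  Everything is expressed by inequalities between coordinates. Testing against the lattice vectors
  \<open>e_r - e_s\<close> and centring \<open>x\<close> between its extreme coordinates shows that the Voronoi cell consists of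
  the \<open>x\<close> in the hyperplane whose coordinates lie within distance 1 of each other. Since the sum of
  all \<open>xi_i\<close> vanishes, \<open>x = (\<Sum>i\<noteq>j. (x_i - x_j) xi_i)\<close>, so the \<open>j\<close>-th diamond is the part of the
  Voronoi cell on which \<open>x_j\<close> is the smallest coordinate. By Abel summation, \<open>sigma0\<close> is the part on
  which the coordinates are decreasing, and permuting the coordinates permutes these parts. Two
  different parts lie on opposite sides of some hyperplane \<open>x_r = x_s\<close> containing neither of them.
  The generators of a diamond have equal lengths and equal pairwise inner products, and every face of
  a parallelepiped is a parallelepiped spanned by a subset of the generators.
\<close>

subsection \<open>Parallelepipeds and hyper-rhombi\<close>

text \<open>The generators form a set, as in \<open>parallelepiped\<close>, so that a face is again
  a \<open>box_span\<close> with a smaller set of generators.\<close>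

definition box_span :: "'a::euclidean_space \<Rightarrow> 'a set \<Rightarrow> 'a set" where
  "box_span p B = {p + (\<Sum>b\<in>B. t b *\<^sub>R b) | t. \<forall>b\<in>B. 0 \<le> t b \<and> t b \<le> 1}"

lemma box_span_translation: "box_span p B = (+) p ` box_span 0 B"
  by (auto simp: box_span_def image_iff)

lemma zero_in_box_span: "0 \<in> box_span 0 B"
  unfolding box_span_def by (auto intro!: exI[of _ "\<lambda>_. 0"])

lemma subset_box_span:
  assumes "finite B"
  shows "B \<subseteq> box_span 0 B"
proof
  fix b assume b: "b \<in> B"
  have "(\<Sum>c\<in>B. of_bool (c = b) *\<^sub>R c) = b"
    using assms b by (simp add: if_distrib[of "\<lambda>x. x *\<^sub>R _"] of_bool_def cong: if_cong)
  then show "b \<in> box_span 0 B"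
    unfolding box_span_def by (auto intro!: exI[of _ "\<lambda>c. of_bool (c = b)"])
qed

lemma box_span_subset_span: "box_span 0 B \<subseteq> span B"
  unfolding box_span_def by (auto intro: span_sum span_scale span_base)

text \<open>After translating \<open>p\<close> to 0, the box contains 0 and every generator, so its
  affine hull is the span of \<open>B\<close>.\<close>

lemma aff_dim_box_span:
  assumes "independent B"
  shows "aff_dim (box_span p B) = int (card B)"
proof -
  have fin: "finite B" using assms by (rule independent_imp_finite)
  have "span (box_span 0 B) = span B"
    using box_span_subset_span[of B] subset_box_span[OF fin]
    by (metis span_mono span_span subset_antisym)
  then have "dim (box_span 0 B) = card B"
    by (metis assms dim_eq_card_independent dim_span)
  then show ?thesis
    using zero_in_box_span[of B] hull_inc[of 0 "box_span 0 B" affine]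
    by (subst box_span_translation) (simp add: aff_dim_translation_eq aff_dim_zero)
qed

text \<open>Passes from indexed generators to a set of generators; injectivity prevents two indices
  from merging into one vector.\<close>

lemma box_span_image:
  assumes "inj_on f I"
  shows "box_span p (f ` I) = {p + (\<Sum>i\<in>I. t i *\<^sub>R f i) | t. \<forall>i\<in>I. 0 \<le> t i \<and> t i \<le> 1}"
proof (intro equalityI subsetI)
  fix x assume "x \<in> box_span p (f ` I)"
  then obtain s where "\<forall>c\<in>f ` I. 0 \<le> s c \<and> s c \<le> 1" "x = p + (\<Sum>c\<in>f ` I. s c *\<^sub>R c)"
    unfolding box_span_def by blast
  then show "x \<in> {p + (\<Sum>i\<in>I. t i *\<^sub>R f i) | t. \<forall>i\<in>I. 0 \<le> t i \<and> t i \<le> 1}"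
    using assms by (auto simp: sum.reindex intro!: exI[of _ "\<lambda>i. s (f i)"])
next
  fix x assume "x \<in> {p + (\<Sum>i\<in>I. t i *\<^sub>R f i) | t. \<forall>i\<in>I. 0 \<le> t i \<and> t i \<le> 1}"
  then obtain t where t: "\<forall>i\<in>I. 0 \<le> t i \<and> t i \<le> 1" "x = p + (\<Sum>i\<in>I. t i *\<^sub>R f i)" by blast
  have "(\<Sum>c\<in>f ` I. t (inv_into I f c) *\<^sub>R c) = (\<Sum>i\<in>I. t i *\<^sub>R f i)"
    using assms by (simp add: sum.reindex)
  then show "x \<in> box_span p (f ` I)"
    unfolding box_span_def using t assms by (auto intro!: exI[of _ "\<lambda>c. t (inv_into I f c)"])
qed

lemma linear_image_box_span:
  assumes "linear f" "inj_on f B"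
  shows "f ` box_span p B = box_span (f p) (f ` B)"
proof -
  have "f (p + (\<Sum>b\<in>B. t b *\<^sub>R b)) = f p + (\<Sum>b\<in>B. t b *\<^sub>R f b)" for t
    using assms(1) by (simp add: linear_add linear_sum linear_scale)
  then show ?thesis
    unfolding box_span_image[OF assms(2)] unfolding box_span_def setcompr_eq_image image_image
    by simp
qed

section \<open>Faces of a parallelepiped\<close>

lemma independent_coeffs_unique:
  fixes B :: "'a::euclidean_space set"
  assumes "independent B" "(\<Sum>b\<in>B. u b *\<^sub>R b) = (\<Sum>b\<in>B. v b *\<^sub>R b)" "b \<in> B"
  shows "u b = v b"
proof -
  have "(\<Sum>b\<in>B. (u b - v b) *\<^sub>R b) = 0"
    using assms(2) by (simp add: scaleR_left_diff_distrib sum_subtractf)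
  then have "u b - v b = 0"
    using independentD[OF assms(1) independent_imp_finite[OF assms(1)] subset_refl, of "\<lambda>b. u b - v b"] assms(3)
    by blast
  then show ?thesis by simp
qed

text \<open>A relative interior point \<open>z\<close> of the face decides everything. Coefficients
  of \<open>z\<close> strictly between 0 and 1 are free on the face and form \<open>D\<close>; the
  others are pinned at 0 or 1 throughout the face.\<close>

lemma face_of_box_span:
  assumes ind: "independent B" and F: "F face_of box_span p B" "F \<noteq> {}"
  shows "\<exists>q D. D \<subseteq> B \<and> F = box_span q D"
proof -
  have fin: "finite B" using ind by (rule independent_imp_finite)
  let ?c = "\<lambda>t. p + (\<Sum>b\<in>B. t b *\<^sub>R b)"
  \<comment> \<open>Valid for every real \<open>e\<close>; below it is used with
    \<open>e > 1\<close>, to extrapolate beyond a point.\<close>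
  have comb: "?c (\<lambda>b. (1 - e) * s b + e * t b) = (1 - e) *\<^sub>R ?c s + e *\<^sub>R ?c t" for e s t
  proof -
    have "(\<Sum>b\<in>B. ((1 - e) * s b + e * t b) *\<^sub>R b) =
        (1 - e) *\<^sub>R (\<Sum>b\<in>B. s b *\<^sub>R b) + e *\<^sub>R (\<Sum>b\<in>B. t b *\<^sub>R b)"
      by (simp add: sum.distrib scaleR_left_distrib scaleR_sum_right)
    then show ?thesis by (simp add: scaleR_right_distrib scaleR_left_diff_distrib)
  qed
  have convF: "convex F" using F(1) by (rule face_of_imp_convex)
  have sub: "F \<subseteq> box_span p B" using F(1) by (rule face_of_imp_subset)
  obtain z where z: "z \<in> rel_interior F"
    using rel_interior_eq_empty[OF convF] F(2) by auto
  then have zF: "z \<in> F" using rel_interior_subset by auto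
  obtain t where t: "\<forall>b\<in>B. 0 \<le> t b \<and> t b \<le> 1" "z = ?c t"
    using zF sub unfolding box_span_def by blast
  define D where "D = {b\<in>B. 0 < t b \<and> t b < 1}"
  define q where "q = p + (\<Sum>b\<in>B-D. t b *\<^sub>R b)"
  have DB: "D \<subseteq> B" by (auto simp: D_def)
  have split: "?c s = p + (\<Sum>b\<in>B-D. s b *\<^sub>R b) + (\<Sum>b\<in>D. s b *\<^sub>R b)" for s
    by (simp add: sum.subset_diff[OF DB fin])
  have "F = box_span q D"
  proof (intro equalityI subsetI)
    fix w assume w: "w \<in> F"
    then obtain s where s: "\<forall>b\<in>B. 0 \<le> s b \<and> s b \<le> 1" "w = ?c s"
      using sub unfolding box_span_def by blast
    \<comment> \<open>The segment from \<open>w\<close> to \<open>z\<close> can be prolonged past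
      \<open>z\<close> inside \<open>F\<close>, because \<open>z\<close> is a relative interior
      point.\<close>
    obtain e where e: "e > 1" "(1 - e) *\<^sub>R w + e *\<^sub>R z \<in> F"
      using z w convex_rel_interior_iff[OF convF F(2)] by blast
    then obtain u where u: "\<forall>b\<in>B. 0 \<le> u b \<and> u b \<le> 1" "(1 - e) *\<^sub>R w + e *\<^sub>R z = ?c u"
      using sub unfolding box_span_def by blast
    have eq: "u b = (1 - e) * s b + e * t b" if "b \<in> B" for b
    proof (rule independent_coeffs_unique[OF ind _ that])
      show "(\<Sum>b\<in>B. u b *\<^sub>R b) = (\<Sum>b\<in>B. ((1 - e) * s b + e * t b) *\<^sub>R b)"
        using comb[of e s t] u(2) s(2) t(2) by simp
    qed
    \<comment> \<open>If \<open>s b\<close> differed from the extreme value \<open>t b\<close>, the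
      extrapolated coefficient \<open>u b\<close> would leave the unit interval.\<close>
    have "s b = t b" if "b \<in> B - D" for b
    proof -
      have b: "b \<in> B" using that by simp
      have "t b = 0 \<or> t b = 1" using t(1)[rule_format, OF b] that unfolding D_def by auto
      then consider "t b = 0" | "t b = 1" by blast
      then show ?thesis
      proof cases
        case 1
        have "(e - 1) * s b \<le> 0" using eq[OF b] u(1) b 1 by (auto simp: algebra_simps)
        then have "s b \<le> 0" using e(1) by (simp add: mult_le_0_iff)
        then show ?thesis using s(1) b 1 by force
      next
        case 2
        have "(e - 1) * (1 - s b) \<le> 0" using eq[OF b] u(1) b 2 by (auto simp: algebra_simps)
        then have "1 - s b \<le> 0" using e(1) by (simp add: mult_le_0_iff)
        then show ?thesis using s(1) b 2 by force
      qed
    qed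
    then have "w = q + (\<Sum>b\<in>D. s b *\<^sub>R b)"
      unfolding s(2) split q_def by simp
    then show "w \<in> box_span q D" unfolding box_span_def using s(1) DB by blast
  next
    fix w assume "w \<in> box_span q D"
    then obtain s0 where s0: "\<forall>b\<in>D. 0 \<le> s0 b \<and> s0 b \<le> 1" "w = q + (\<Sum>b\<in>D. s0 b *\<^sub>R b)"
      unfolding box_span_def by blast
    define s where "s b = (if b \<in> D then s0 b else t b)" for b
    have ws: "w = ?c s" unfolding split s0(2) q_def s_def by simp
    have s: "0 \<le> s b \<and> s b \<le> 1" if "b \<in> B" for b
      using s0(1) t(1) that by (auto simp: s_def)
    \<comment> \<open>The distance of the free coefficients of \<open>z\<close> from 0 and 1 bounds
      how far past \<open>z\<close> one may go; the inserted 1 keeps \<open>Min\<close> meaningful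
      when \<open>D\<close> is empty.\<close>
    define d where "d = Min (insert 1 ((\<lambda>b. min (t b) (1 - t b)) ` D))"
    have finD: "finite D" using fin DB by (rule rev_finite_subset)
    have d0: "d > 0" unfolding d_def using finD by (subst Min_gr_iff) (auto simp: D_def)
    have d: "d \<le> t b \<and> d \<le> 1 - t b" if "b \<in> D" for b
    proof -
      have "d \<le> min (t b) (1 - t b)" unfolding d_def using finD that by (intro Min_le) auto
      then show ?thesis by simp
    qed
    \<comment> \<open>A point of the box beyond \<open>z\<close> as seen from \<open>w\<close>. It
      puts \<open>z\<close> inside an open segment starting at \<open>w\<close>, and the face
      property then forces \<open>w\<close> into \<open>F\<close>.\<close>
    let ?w' = "(1 - (1 + d)) *\<^sub>R w + (1 + d) *\<^sub>R z"
    have inS: "w \<in> box_span p B" unfolding box_span_def ws using s by blast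
    have "0 \<le> (1 - (1 + d)) * s b + (1 + d) * t b \<and> (1 - (1 + d)) * s b + (1 + d) * t b \<le> 1"
      if b: "b \<in> B" for b
    proof (cases "b \<in> D")
      case True
      have "d * (s b - t b) \<le> d * 1" "d * (t b - s b) \<le> d * 1"
        using s[OF b] t(1) b d0 by (auto intro!: mult_left_mono)
      then show ?thesis using d[OF True] by (auto simp: algebra_simps)
    next
      case False
      then show ?thesis using t(1) b by (auto simp: s_def algebra_simps)
    qed
    then have w'S: "?w' \<in> box_span p B"
      unfolding ws t(2) comb[symmetric] box_span_def
      by (intro CollectI exI[of _ "\<lambda>b. (1 - (1 + d)) * s b + (1 + d) * t b"]) simp
    show "w \<in> F"
    proof (cases "w = z")
      case False
      have zeq: "z = (1 - 1 / (1 + d)) *\<^sub>R w + (1 / (1 + d)) *\<^sub>R ?w'"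
        using d0 by (simp add: algebra_simps divide_simps) 
          (simp add: scaleR_left_distrib[symmetric] scaleR_left_diff_distrib[symmetric] add_divide_distrib[symmetric])
      have ne: "w \<noteq> ?w'"
      proof
        assume a: "w = ?w'"
        then have "(1 + d) *\<^sub>R (z - w) = 0" by (simp add: algebra_simps)
        then show False using d0 False by simp
      qed
      have "z \<in> open_segment w ?w'"
        unfolding in_segment using zeq ne d0 by (intro conjI exI[of _ "1 / (1 + d)"]) auto
      then show ?thesis using F(1) inS w'S zF unfolding face_of_def by blast
    qed (use zF in simp)
  qed
  then show ?thesis using DB by blast
qed

section \<open>Congruence of facets\<close>

text \<open>For \<open>u = 0\<close> the map is the identity, which covers the case that the two
  generators removed below coincide.\<close>

lemma reflection_isometry:
  fixes u :: "'a::euclidean_space"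
  defines "\<rho> \<equiv> \<lambda>x. x - (2 * (x \<bullet> u) / (u \<bullet> u)) *\<^sub>R u"
  shows "linear \<rho>" "norm (\<rho> x) = norm x"
proof -
  show "linear \<rho>"
    unfolding \<rho>_def by (rule linearI) (simp_all add: algebra_simps inner_add_left add_divide_distrib)
  have "\<rho> x \<bullet> \<rho> x = x \<bullet> x"
  proof (cases "u = 0")
    case False
    then show ?thesis unfolding \<rho>_def
      by (simp add: inner_diff_left inner_diff_right inner_commute[of u x] field_simps)
  qed (simp add: \<rho>_def)
  then show "norm (\<rho> x) = norm x" by (simp add: norm_eq_sqrt_inner)
qed

text \<open>The reflection in \<open>b - c\<close> swaps \<open>b\<close> and \<open>c\<close> and fixes the other elements of \<open>B\<close>,
  because these have equal inner products with \<open>b\<close> and \<open>c\<close>.\<close>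

lemma congruent_sets_box_span_remove:
  assumes ind: "independent B" and norms: "\<And>b. b \<in> B \<Longrightarrow> b \<bullet> b = r"
    and angles: "\<And>b c. b \<in> B \<Longrightarrow> c \<in> B \<Longrightarrow> b \<noteq> c \<Longrightarrow> b \<bullet> c = g"
    and b: "b \<in> B" and c: "c \<in> B"
  shows "congruent_sets (box_span p (B - {b})) (box_span q (B - {c}))"
proof -
  define u where "u = b - c"
  define \<rho> where "\<rho> = (\<lambda>x. x - (2 * (x \<bullet> u) / (u \<bullet> u)) *\<^sub>R u)"
  have lin: "linear \<rho>" and nrm: "\<And>x. norm (\<rho> x) = norm x"
    unfolding \<rho>_def by (rule reflection_isometry)+
  have img: "\<rho> a = (if a = b then c else if a = c then b else a)" if a: "a \<in> B" for a
  proof (cases "b = c")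
    case True
    then show ?thesis by (simp add: \<rho>_def u_def)
  next
    case False
    have uu: "u \<bullet> u = 2 * r - 2 * g"
      using norms[OF b] norms[OF c] angles[OF b c False]
      by (simp add: u_def inner_diff_left inner_diff_right inner_commute)
    have pos: "u \<bullet> u \<noteq> 0" using False by (simp add: u_def)
    have "b \<bullet> u = (u \<bullet> u) / 2" "c \<bullet> u = - (u \<bullet> u) / 2"
      using norms[OF b] norms[OF c] angles[OF b c False] uu
      by (simp_all add: u_def inner_diff_right inner_commute)
    then have "2 * (b \<bullet> u) / (u \<bullet> u) = 1" "2 * (c \<bullet> u) / (u \<bullet> u) = - 1"
      using pos by simp_all
    then have "\<rho> b = b - 1 *\<^sub>R u" "\<rho> c = c - (- 1) *\<^sub>R u" unfolding \<rho>_def by (simp_all only:)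
    then have "\<rho> b = c" "\<rho> c = b" by (simp_all add: u_def)
    moreover have "\<rho> a = a" if "a \<noteq> b" "a \<noteq> c"
      using angles[OF a b] angles[OF a c] that by (simp add: \<rho>_def u_def inner_diff_right)
    ultimately show ?thesis by auto
  qed
  have inj: "inj_on \<rho> B" by (rule inj_onI) (auto simp: img split: if_splits)
  have imB: "\<rho> ` (B - {b}) = B - {c}"
    using b c by (auto simp: img image_iff split: if_splits)
  \<comment> \<open>The added translation carries the corner \<open>p\<close> to the corner
    \<open>q\<close> once the reflection has matched the generators.\<close>
  define f where "f x = \<rho> x + (q - \<rho> p)" for x
  have "f ` box_span p (B - {b}) = box_span q (B - {c})"
  proof -
    have "f ` box_span p (B - {b}) = (+) (q - \<rho> p) ` \<rho> ` box_span p (B - {b})"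
      unfolding f_def by (auto simp: image_image add.commute)
    also have "\<rho> ` box_span p (B - {b}) = box_span (\<rho> p) (B - {c})"
      using linear_image_box_span[OF lin, of "B - {b}" p] inj imB by (simp add: inj_on_diff)
    also have "(+) (q - \<rho> p) ` \<dots> = box_span q (B - {c})"
      by (subst (1 2) box_span_translation) (simp add: image_image algebra_simps)
    finally show ?thesis .
  qed
  moreover have "dist (f x) (f y) = dist x y" for x y
    unfolding f_def dist_norm using nrm[of "x - y"] lin by (simp add: linear_diff)
  ultimately show ?thesis unfolding congruent_sets_def by blast
qed

lemma rhombus_box_span:
  assumes "independent B" "card B = 2" "\<And>b. b \<in> B \<Longrightarrow> b \<bullet> b = r"
  shows "rhombus (box_span p B)"
proof -
  obtain u v where uv: "B = {u, v}" "u \<noteq> v" using assms(2) by (auto simp: card_2_iff)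
  have "norm u = norm v" using assms(3) uv by (simp add: norm_eq_sqrt_inner)
  moreover have "box_span p B =
    {p + s *\<^sub>R u + t *\<^sub>R v | s t. 0 \<le> s \<and> s \<le> 1 \<and> 0 \<le> t \<and> t \<le> 1}" (is "_ = ?R")
  proof (intro equalityI subsetI)
    fix x assume "x \<in> ?R"
    then obtain s t where "x = p + s *\<^sub>R u + t *\<^sub>R v" "0 \<le> s" "s \<le> 1" "0 \<le> t" "t \<le> 1" by blast
    then show "x \<in> box_span p B" unfolding box_span_def using uv
      by (auto intro!: exI[of _ "\<lambda>b. if b = u then s else t"])
  qed (use uv in \<open>auto simp: box_span_def add.assoc\<close>)
  ultimately show ?thesis unfolding rhombus_def using uv assms(1) by blast
qed

text \<open>Equal lengths and equal pairwise inner products are inherited by subsets of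
  \<open>B\<close>, so induction on the dimension applies to the facets.\<close>

lemma hyper_rhombus_box_span:
  assumes "independent B" "card B = m" "m \<ge> 2" and norms: "\<And>b. b \<in> B \<Longrightarrow> b \<bullet> b = r"
    and "\<And>b c. b \<in> B \<Longrightarrow> c \<in> B \<Longrightarrow> b \<noteq> c \<Longrightarrow> b \<bullet> c = g"
  shows "hyper_rhombus m (box_span p B)"
  using assms
proof (induction m arbitrary: B p)
  case (Suc m)
  show ?case
  proof (cases "m = 1")
    case True
    then show ?thesis using rhombus_box_span[of B r p] Suc.prems by simp
  next
    case False
    then have m: "m \<ge> 2" using Suc.prems by simp
    have fin: "finite B" using Suc.prems(1) by (rule independent_imp_finite)
    \<comment> \<open>A face of dimension \<open>m\<close> is spanned by \<open>m\<close> of the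
      \<open>m + 1\<close> generators, so exactly one is missing.\<close>
    have facet: "\<exists>b\<in>B. \<exists>q. F = box_span q (B - {b})"
      if F: "F face_of box_span p B" "aff_dim F = int m" for F
    proof -
      have "F \<noteq> {}" using F(2) by auto
      then obtain q D where D: "D \<subseteq> B" "F = box_span q D"
        using face_of_box_span[OF Suc.prems(1) F(1)] by blast
      have "card D = m"
        using aff_dim_box_span[of D q] D F(2) independent_mono[OF Suc.prems(1) D(1)] by simp
      then have "card (B - D) = 1"
        using Suc.prems(2) D(1) fin by (simp add: card_Diff_subset finite_subset)
      then obtain b where "B - D = {b}" by (auto simp: card_1_singleton_iff)
      then have "b \<in> B" "D = B - {b}" using D(1) by auto
      then show ?thesis using D(2) by blast
    qed
    have "parallelepiped (Suc m) (box_span p B)"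
      unfolding parallelepiped_def box_span_def using Suc.prems by blast
    moreover have "hyper_rhombus m F"
      if F: "F face_of box_span p B" "aff_dim F = int m" for F
    proof -
      obtain b q where b: "b \<in> B" "F = box_span q (B - {b})" using facet[OF F] by blast
      show ?thesis unfolding b(2)
      proof (rule Suc.IH)
        show "independent (B - {b})" using Suc.prems(1) by (rule independent_mono) auto
      qed (use Suc.prems b m fin in auto)
    qed
    moreover have "congruent_sets F G"
      if F: "F face_of box_span p B" "aff_dim F = int m" "G face_of box_span p B" "aff_dim G = int m"
      for F G
    proof -
      obtain b q where b: "b \<in> B" "F = box_span q (B - {b})" using facet[OF F(1,2)] by blast
      obtain c s where c: "c \<in> B" "G = box_span s (B - {c})" using facet[OF F(3,4)] by blast
      show ?thesis unfolding b(2) c(2)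
        using Suc.prems(1,4,5) b(1) c(1) by (rule congruent_sets_box_span_remove)
    qed
    ultimately show ?thesis using m by simp
  qed
qed simp

subsection \<open>Disjoint unions\<close>

text \<open>Prolonging the segment from \<open>w\<close> past \<open>z\<close> multiplies
  \<open>f w\<close> by the negative number \<open>1 - e\<close>, so \<open>f w\<close> cannot be
  positive.\<close>

lemma rel_interior_zero_imp_zero:
  fixes f :: "'a::euclidean_space \<Rightarrow> real"
  assumes "linear f" "convex P" "z \<in> rel_interior P" "\<And>x. x \<in> P \<Longrightarrow> f x \<ge> 0" "f z = 0" "w \<in> P"
  shows "f w = 0"
proof -
  have "P \<noteq> {}" using assms(6) by blast
  then obtain e where e: "e > 1" "(1 - e) *\<^sub>R w + e *\<^sub>R z \<in> P"
    using convex_rel_interior_iff[OF assms(2), of z] assms(3,6) by blast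
  have "(1 - e) * f w \<ge> 0"
    using assms(4)[OF e(2)] assms(1,5) by (simp add: linear_add linear_scale)
  then have "f w \<le> 0" using e(1) by (simp add: zero_le_mult_iff)
  then show ?thesis using assms(4)[OF assms(6)] by simp
qed

text \<open>At a common relative interior point \<open>f\<close> would vanish, hence on all of
  \<open>P\<close>, contradicting \<open>w\<close>.\<close>

lemma disjoint_rel_interior_separated:
  fixes f :: "'a::euclidean_space \<Rightarrow> real"
  assumes "linear f" "convex P" "convex Q" "\<And>x. x \<in> P \<Longrightarrow> f x \<ge> 0" "\<And>x. x \<in> Q \<Longrightarrow> f x \<le> 0"
    "w \<in> P" "f w \<noteq> 0"
  shows "rel_interior P \<inter> rel_interior Q = {}"
proof (rule ccontr)
  assume "rel_interior P \<inter> rel_interior Q \<noteq> {}"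
  then obtain z where z: "z \<in> rel_interior P" "z \<in> rel_interior Q" by blast
  then have "f z = 0" using assms(4)[of z] assms(5)[of z] rel_interior_subset by force
  then show False using rel_interior_zero_imp_zero[OF assms(1,2) z(1) assms(4)] assms(6,7) by blast
qed

text \<open>Distinct indices in \<open>K\<close> have distinct preimages under \<open>h\<close>, so
  surjectivity of \<open>h\<close> onto \<open>K\<close> is enough to keep interiors
  disjoint.\<close>

lemma disjoint_union_of_reindex:
  assumes "disjoint_union_of I P S" "h ` I = K" "\<And>i. i \<in> I \<Longrightarrow> R (h i) = P i"
  shows "disjoint_union_of K R S"
proof -
  have "rel_interior (R k) \<inter> rel_interior (R l) = {}" if kl: "k \<in> K" "l \<in> K" "k \<noteq> l" for k l
  proof -
    obtain i j where "i \<in> I" "j \<in> I" "k = h i" "l = h j" using kl assms(2) by blast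
    moreover from this have "i \<noteq> j" using kl(3) by blast
    ultimately show ?thesis using assms(1,3) unfolding disjoint_union_of_def by simp
  qed
  then show ?thesis using assms unfolding disjoint_union_of_def by auto
qed

text \<open>The number of pieces equals the number of indices: the pieces have nonempty relative
  interior, so two indices with disjoint interiors cannot give the same set.\<close>

lemma composed_of_congruent_image:
  assumes du: "disjoint_union_of I P S" and "finite I" "aff_dim S \<ge> 0"
    and cong: "\<And>i j. i \<in> I \<Longrightarrow> j \<in> I \<Longrightarrow> congruent_sets (P i) (P j)"
  shows "composed_of_congruent (card I) (P ` I) S"
proof -
  have ne: "rel_interior (P i) \<noteq> {}" if "i \<in> I" for i
  proof -
    have "polytope (P i)" "aff_dim (P i) = aff_dim S"
      using du that unfolding disjoint_union_of_def by auto
    then show ?thesis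
      using rel_interior_eq_empty[of "P i"] polytope_imp_convex[of "P i"] assms(3) by auto
  qed
  have "inj_on P I"
  proof (rule inj_onI, rule ccontr)
    fix i j assume *: "i \<in> I" "j \<in> I" "P i = P j" "i \<noteq> j"
    then have "rel_interior (P i) \<inter> rel_interior (P j) = {}"
      using du unfolding disjoint_union_of_def by blast
    then show False using ne[of i] * by simp
  qed
  moreover have "disjoint_union_of (P ` I) (\<lambda>T. T) S"
    using du by (rule disjoint_union_of_reindex) auto
  ultimately show ?thesis
    unfolding composed_of_congruent_def using assms(2) cong by (auto simp: card_image)
qed

text \<open>Sorting by induction: a minimiser of \<open>f\<close> goes to the last place. This
  supplies the permutation that puts a point of a diamond into one of its simplices.\<close>

lemma antitone_enumeration:
  fixes f :: "'a \<Rightarrow> real"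
  assumes "finite S"
  shows "\<exists>g. bij_betw g {1..card S} S \<and> (\<forall>i\<in>{1..card S}. \<forall>j\<in>{1..card S}. i \<le> j \<longrightarrow> f (g j) \<le> f (g i))"
  using assms
proof (induction "card S" arbitrary: S)
  case 0
  then show ?case by (auto simp: bij_betw_def)
next
  case (Suc k)
  then have "S \<noteq> {}" by auto
  then obtain m where m: "m \<in> S" "\<And>x. x \<in> S \<Longrightarrow> f m \<le> f x"
    using ex_min_if_finite[of "f ` S"] Suc.prems by (metis finite_imageI arg_min_if_finite(1) arg_min_least)
  have k: "k = card (S - {m})" using Suc m by simp
  obtain g where g: "bij_betw g {1..k} (S - {m})"
    "\<forall>i\<in>{1..k}. \<forall>j\<in>{1..k}. i \<le> j \<longrightarrow> f (g j) \<le> f (g i)"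
    using Suc.hyps(1)[OF k] Suc.prems k by auto
  define h where "h = g(Suc k := m)"
  have h: "bij_betw h {1..k} (S - {m})"
    using g(1) by (rule bij_betw_cong[THEN iffD1, rotated]) (auto simp: h_def)
  then have "bij_betw h ({1..k} \<union> {Suc k}) ((S - {m}) \<union> {m})"
    by (rule bij_betw_combine) (auto simp: h_def bij_betw_def)
  moreover have "{1..k} \<union> {Suc k} = {1..card S}" "(S - {m}) \<union> {m} = S"
    using Suc.hyps(2) m(1) by auto
  ultimately have bij: "bij_betw h {1..card S} S" by (simp only:)
  moreover have "f (h j) \<le> f (h i)" if "i \<in> {1..card S}" "j \<in> {1..card S}" "i \<le> j" for i j
  proof (cases "j = Suc k")
    case True
    have "h i \<in> S" using bij_betwE[OF bij] that(1) by blast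
    then show ?thesis using True m(2) by (simp add: h_def)
  next
    case False
    then show ?thesis using that g(2) Suc.hyps(2)[symmetric] by (auto simp: h_def)
  qed
  then show ?case using bij by auto
qed

subsection \<open>The Voronoi cell in coordinates\<close>

lemma hyperplane_H_iff: "x \<in> hyperplane_H \<longleftrightarrow> (\<Sum>r\<in>UNIV. x $ r) = 0"
  by (simp add: hyperplane_H_def inner_vec_def)

text \<open>Summing the coordinates forces \<open>c = 0\<close>. Points of the hyperplane can thus
  be compared up to a common additive constant, such as the correction inside
  \<open>xi\<close>.\<close>

lemma hyperplane_H_eqI:
  fixes x y :: "real ^ 'm"
  assumes "x \<in> hyperplane_H" "y \<in> hyperplane_H" "\<And>r. x $ r = y $ r + c"
  shows "x = y"
proof -
  have "(\<Sum>r\<in>UNIV. x $ r) = (\<Sum>r\<in>UNIV. y $ r) + real CARD('m) * c"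
    using assms(3) by (simp add: sum.distrib)
  then have "c = 0" using assms(1,2) by (simp add: hyperplane_H_iff)
  then show ?thesis using assms(3) by (simp add: vec_eq_iff)
qed

lemma subspace_hyperplane_H: "subspace (hyperplane_H :: (real ^ 'm) set)"
  unfolding hyperplane_H_def by (auto simp: subspace_def inner_add_left)

lemma aff_dim_hyperplane_H: "aff_dim (hyperplane_H :: (real ^ 'm) set) = int (CARD('m) - 1)"
proof -
  have "(1 :: real ^ 'm) \<noteq> 0" by (simp add: vec_eq_iff)
  then show ?thesis
    using aff_dim_hyperplane[of "1 :: real ^ 'm" 0]
    by (simp add: hyperplane_H_def inner_commute)
qed

lemma voronoi_cell_0_eq:
  "(voronoi_cell_0 :: (real ^ 'm) set) = {x \<in> hyperplane_H. \<forall>r s. x $ r - x $ s \<le> 1}" (is "_ = ?V")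
proof -
  have key: "norm x \<le> norm (x - q) \<longleftrightarrow> 2 * (x \<bullet> q) \<le> q \<bullet> q" for x q :: "real ^ 'm"
    by (simp add: norm_le inner_diff_left inner_diff_right inner_commute[of q x])
  show ?thesis
  proof (intro equalityI subsetI)
    fix x :: "real ^ 'm" assume "x \<in> voronoi_cell_0"
    then have x: "x \<in> hyperplane_H" "\<And>q. q \<in> lattice_A \<Longrightarrow> 2 * (x \<bullet> q) \<le> q \<bullet> q"
      unfolding voronoi_cell_0_def using key by auto
    have "x $ r - x $ s \<le> 1" for r s
    proof (cases "r = s")
      case False
      let ?q = "axis r 1 - axis s 1 :: real ^ 'm"
      have "?q \<in> lattice_A"
        by (auto simp: lattice_A_def hyperplane_H_def inner_diff_left inner_axis') (simp add: axis_def)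
      moreover have "?q \<bullet> ?q = 2"
        using False by (simp add: inner_diff_left inner_axis') (simp add: axis_def)
      ultimately show ?thesis using x(2)[of ?q] by (simp add: inner_diff_right inner_axis)
    qed simp
    then show "x \<in> ?V" using x(1) by blast
  next
    fix x :: "real ^ 'm" assume "x \<in> ?V"
    then have x: "x \<in> hyperplane_H" "\<And>r s. x $ r - x $ s \<le> 1" by auto
    \<comment> \<open>The midpoint of the extreme coordinates, so each coordinate is within 1/2 of
      \<open>c\<close>. Subtracting \<open>c *\<^sub>R 1\<close> does not change inner products with
      lattice vectors.\<close>
    define c where "c = (Max (range (($) x)) + Min (range (($) x))) / 2"
    have c: "\<bar>x $ r - c\<bar> \<le> 1 / 2" for r
    proof -
      have "Max (range (($) x)) \<in> range (($) x)" "Min (range (($) x)) \<in> range (($) x)"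
        by (intro Max_in Min_in; simp)+
      then obtain a b where "Max (range (($) x)) = x $ a" "Min (range (($) x)) = x $ b" by blast
      then have "Max (range (($) x)) - Min (range (($) x)) \<le> 1" using x(2) by simp
      moreover have "x $ r \<le> Max (range (($) x))" "Min (range (($) x)) \<le> x $ r" by auto
      ultimately show ?thesis unfolding c_def abs_le_iff by (intro conjI; argo)
    qed
    have "2 * (x \<bullet> q) \<le> q \<bullet> q" if "q \<in> lattice_A" for q
    proof -
      have q: "q \<bullet> 1 = 0" "\<And>r. q $ r \<in> \<int>"
        using that by (auto simp: lattice_A_def hyperplane_H_def)
      have "2 * (x \<bullet> q) = 2 * ((x - c *\<^sub>R 1) \<bullet> q)"
        using q(1) by (simp add: inner_diff_left inner_commute[of 1 q])
      also have "\<dots> = (\<Sum>r\<in>UNIV. 2 * (x $ r - c) * q $ r)"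
        by (simp add: inner_vec_def sum_distrib_left algebra_simps)
      also have "\<dots> \<le> (\<Sum>r\<in>UNIV. q $ r * q $ r)"
      proof (rule sum_mono)
        fix r
        have "2 * (x $ r - c) * q $ r \<le> \<bar>2 * (x $ r - c)\<bar> * \<bar>q $ r\<bar>"
          by (metis abs_ge_self abs_mult)
        also have "\<dots> \<le> 1 * \<bar>q $ r\<bar>" using c[of r] by (intro mult_right_mono) (simp_all add: abs_mult del: right_diff_distrib_numeral)
        \<comment> \<open>Integrality enters here: a nonzero integer has absolute value at least
          1.\<close>
        also have "\<dots> \<le> q $ r * q $ r"
        proof (cases "q $ r = 0")
          case False
          then have "1 \<le> \<bar>q $ r\<bar>" using q(2)[of r] by (rule Ints_nonzero_abs_ge1[rotated])
          then have "1 * \<bar>q $ r\<bar> \<le> \<bar>q $ r\<bar> * \<bar>q $ r\<bar>" by (intro mult_right_mono) auto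
          then show ?thesis by (simp add: abs_mult[symmetric])
        qed simp
        finally show "2 * (x $ r - c) * q $ r \<le> q $ r * q $ r" .
      qed
      finally show ?thesis by (simp add: inner_vec_def)
    qed
    then show "x \<in> voronoi_cell_0" using x(1) key by (simp add: voronoi_cell_0_def)
  qed
qed

section \<open>Pieces described by inequalities\<close>

text \<open>These turn out to be the diamonds. The index is a coordinate and not its number, so the
  set is independent of any numbering.\<close>

definition cell :: "'m::finite \<Rightarrow> (real ^ 'm) set" where
  "cell J = {x \<in> hyperplane_H. \<forall>r. x $ J \<le> x $ r \<and> x $ r \<le> x $ J + 1}"

text \<open>For \<open>q = pos\<close> this is \<open>sigma0\<close>. Its images under coordinate
  permutations are obtained by changing the numbering \<open>q\<close> alone.\<close>

definition chain :: "('m::finite \<Rightarrow> nat) \<Rightarrow> (real ^ 'm) set" where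
  "chain q = {x \<in> hyperplane_H. \<forall>r s. q r \<le> q s \<longrightarrow> x $ s \<le> x $ r \<and> x $ r \<le> x $ s + 1}"

lemma voronoi_cell_0_eq_Union_cell: "voronoi_cell_0 = (\<Union>J. cell J)"
proof (intro equalityI subsetI)
  fix x :: "real ^ 'm" assume x: "x \<in> voronoi_cell_0"
  have "Min (range (($) x)) \<in> range (($) x)" by (intro Min_in) simp_all
  then obtain J where "x $ J = Min (range (($) x))" by (metis imageE)
  then have "x $ J \<le> x $ r" for r by simp
  moreover have "x $ r \<le> x $ J + 1" for r
    using x by (simp add: voronoi_cell_0_eq) (smt (verit))
  ultimately have "x \<in> cell J" using x by (simp add: cell_def voronoi_cell_0_eq)
  then show "x \<in> (\<Union>J. cell J)" by blast
next
  fix x :: "real ^ 'm" assume "x \<in> (\<Union>J. cell J)"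
  then obtain J where J: "x \<in> hyperplane_H" "\<And>r. x $ J \<le> x $ r" "\<And>r. x $ r \<le> x $ J + 1"
    unfolding cell_def by blast
  have "x $ r - x $ s \<le> 1" for r s using J(2)[of s] J(3)[of r] by simp
  then show "x \<in> voronoi_cell_0" using J(1) by (simp add: voronoi_cell_0_eq)
qed

text \<open>The cell is the orthogonal projection \<open>?L\<close> of the facet of the unit cube on
  which coordinate \<open>J\<close> is 0.\<close>

lemma polytope_cell: "polytope (cell J :: (real ^ 'm) set)"
proof -
  let ?L = "\<lambda>t :: real ^ 'm. t - ((\<Sum>r\<in>UNIV. t $ r) / real CARD('m)) *\<^sub>R 1"
  have lin: "linear ?L"
    by (rule linearI)
      (simp_all add: vec_eq_iff sum.distrib add_divide_distrib sum_distrib_left[symmetric] right_diff_distrib)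
  have "cell J = ?L ` cbox 0 (1 - axis J 1)"
  proof (intro equalityI subsetI)
    fix x :: "real ^ 'm" assume x: "x \<in> cell J"
    have "x = ?L (x - (x $ J) *\<^sub>R 1)"
      using x by (simp add: cell_def hyperplane_H_iff sum_subtractf)
    moreover have "x - (x $ J) *\<^sub>R 1 \<in> cbox 0 (1 - axis J 1)"
      using x by (auto simp: mem_box_cart cell_def axis_def algebra_simps)
    ultimately show "x \<in> ?L ` cbox 0 (1 - axis J 1)" by blast
  next
    fix x :: "real ^ 'm" assume "x \<in> ?L ` cbox 0 (1 - axis J 1)"
    then obtain t where t: "x = ?L t" "\<And>r. 0 \<le> t $ r" "\<And>r. t $ r \<le> 1 - axis J 1 $ r"
      by (auto simp: mem_box_cart)
    have "x \<in> hyperplane_H" by (simp add: t(1) hyperplane_H_iff sum_subtractf)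
    moreover have "t $ J = 0" using t(2)[of J] t(3)[of J] by (simp add: axis_def)
    moreover have "t $ r \<le> 1" for r using t(3)[of r] by (simp add: axis_def split: if_splits)
    ultimately show "x \<in> cell J" using t(2) by (simp add: cell_def t(1))
  qed
  then show ?thesis using polytope_linear_image[OF lin polytope_interval] by simp
qed

lemma disjoint_rel_interior_cells:
  fixes J K :: "'m::finite"
  assumes "J \<noteq> K"
  shows "rel_interior (cell J) \<inter> rel_interior (cell K) = {}"
proof -
  \<comment> \<open>The projected unit vector at \<open>K\<close>: it lies in \<open>cell J\<close>
    but off the hyperplane where coordinates \<open>J\<close> and \<open>K\<close> agree.\<close>
  define w :: "real ^ 'm" where "w = axis K 1 - (1 / real CARD('m)) *\<^sub>R 1"
  have w: "w $ r = of_bool (r = K) - 1 / real CARD('m)" for r by (simp add: w_def axis_def)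
  have "w \<in> hyperplane_H" by (simp add: hyperplane_H_iff w sum_subtractf of_bool_def)
  then have "w \<in> cell J" using assms by (simp add: cell_def w)
  moreover have "w $ K - w $ J \<noteq> 0" using assms by (simp add: w)
  moreover have "linear (\<lambda>x :: real ^ 'm. x $ K - x $ J)"
    by (rule linearI) (simp_all add: algebra_simps)
  moreover have "x $ K - x $ J \<ge> 0" if "x \<in> cell J" for x using that by (simp add: cell_def)
  moreover have "x $ K - x $ J \<le> 0" if "x \<in> cell K" for x using that by (simp add: cell_def)
  ultimately show ?thesis
    by (intro disjoint_rel_interior_separated[of "\<lambda>x. x $ K - x $ J" _ _ w])
      (auto intro: polytope_imp_convex polytope_cell)
qed

subsection \<open>Permuting coordinates\<close>

text \<open>The inverse makes a bijection \<tau> send the unit vector at \<open>c\<close> to the one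
  at \<open>\<tau> c\<close>, in agreement with the matrix having its ones at the entries
  \<open>(\<tau> c, c)\<close>.\<close>

definition permute_coords :: "('m \<Rightarrow> 'm) \<Rightarrow> real ^ 'm \<Rightarrow> real ^ 'm::finite" where
  "permute_coords \<tau> x = (\<chi> r. x $ inv \<tau> r)"

lemma matrix_permute_coords:
  assumes "bij \<tau>"
  shows "(\<chi> r c. of_bool (r = \<tau> c)) *v x = permute_coords \<tau> x"
proof -
  have "r = \<tau> c \<longleftrightarrow> c = inv \<tau> r" for r c using assms by (metis bij_inv_eq_iff)
  then show ?thesis
    by (simp add: permute_coords_def matrix_vector_mult_def vec_eq_iff of_bool_def
        if_distrib[of "\<lambda>y. y * _"] cong: if_cong)
qed

lemma permute_coords_sum:
  assumes "bij \<tau>"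
  shows "(\<Sum>r\<in>UNIV. f (permute_coords \<tau> x $ r)) = (\<Sum>r\<in>UNIV. f (x $ r))"
  unfolding permute_coords_def
  using sum.reindex_bij_betw[OF bij_imp_bij_inv[OF assms], of "\<lambda>r. f (x $ r)"] by simp

lemma permute_coords_inv:
  assumes "bij \<tau>"
  shows "permute_coords \<tau> (permute_coords (inv \<tau>) x) = x"
  using assms by (simp add: permute_coords_def vec_eq_iff inv_inv_eq bij_is_surj surj_f_inv_f)

lemma dist_permute_coords:
  assumes "bij \<tau>"
  shows "dist (permute_coords \<tau> x) (permute_coords \<tau> y) = dist x y"
proof -
  have "permute_coords \<tau> x - permute_coords \<tau> y = permute_coords \<tau> (x - y)"
    by (simp add: permute_coords_def vec_eq_iff)
  then show ?thesis
    using permute_coords_sum[OF assms, of "\<lambda>t. t\<^sup>2" "x - y"]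
    by (simp add: dist_norm norm_vec_def L2_set_def)
qed

lemma permute_coords_in_H:
  assumes "bij \<tau>"
  shows "permute_coords \<tau> x \<in> hyperplane_H \<longleftrightarrow> x \<in> hyperplane_H"
  using permute_coords_sum[OF assms, of "\<lambda>t. t" x] by (simp add: hyperplane_H_iff)

text \<open>Surjectivity of the permutation turns an equivalence of memberships into an equation
  between sets.\<close>

lemma permute_coords_image:
  assumes "bij \<tau>" "\<And>x. permute_coords \<tau> x \<in> T \<longleftrightarrow> x \<in> S"
  shows "permute_coords \<tau> ` S = T"
  using assms(2) permute_coords_inv[OF assms(1)] by (metis image_eqI image_subset_iff subsetI subset_antisym)

lemma permute_coords_cell:
  assumes "bij \<tau>"
  shows "permute_coords \<tau> ` cell J = cell (\<tau> J)"
proof (rule permute_coords_image[OF assms])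
  have all: "(\<forall>r. P (inv \<tau> r)) \<longleftrightarrow> (\<forall>r. P r)" for P
    using assms by (metis bij_inv_eq_iff)
  show "permute_coords \<tau> x \<in> cell (\<tau> J) \<longleftrightarrow> x \<in> cell J" for x
    using assms all[of "\<lambda>r. x $ J \<le> x $ r \<and> x $ r \<le> x $ J + 1"]
    unfolding cell_def mem_Collect_eq permute_coords_in_H[OF assms]
    by (simp add: permute_coords_def bij_is_inj)
qed

lemma permute_coords_chain:
  assumes "bij \<tau>"
  shows "permute_coords \<tau> ` chain q = chain (q \<circ> inv \<tau>)"
proof (rule permute_coords_image[OF assms])
  have all: "(\<forall>r s. P (inv \<tau> r) (inv \<tau> s)) \<longleftrightarrow> (\<forall>r s. P r s)" for P
    using assms by (metis bij_inv_eq_iff)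
  show "permute_coords \<tau> x \<in> chain (q \<circ> inv \<tau>) \<longleftrightarrow> x \<in> chain q" for x
    using all[of "\<lambda>r s. q r \<le> q s \<longrightarrow> x $ s \<le> x $ r \<and> x $ r \<le> x $ s + 1"]
    unfolding chain_def mem_Collect_eq permute_coords_in_H[OF assms]
    by (simp add: permute_coords_def)
qed

lemma congruent_sets_permute_coords:
  "bij \<tau> \<Longrightarrow> congruent_sets S (permute_coords \<tau> ` S)"
  unfolding congruent_sets_def using dist_permute_coords by blast

lemma congruent_sets_cell: "congruent_sets (cell J) (cell K)"
  using congruent_sets_permute_coords[of "Transposition.transpose J K" "cell J"]
  by (simp add: permute_coords_cell)

lemma mod_eq_imp_eq:
  fixes i j m :: nat
  assumes "i \<in> {1..m}" "j \<in> {1..m}" "i mod m = j mod m"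
  shows "i = j"
proof -
  have "k mod m = (if k = m then 0 else k)" if "k \<in> {1..m}" for k using that by auto
  then show ?thesis using assms by (auto split: if_splits)
qed

lemma mod_add_right_cancel_nat:
  fixes i j k m :: nat
  assumes "(i + k) mod m = (j + k) mod m"
  shows "i mod m = j mod m"
proof -
  obtain a b where "i + k + m * a = j + k + m * b" using assms nat_mod_eq_iff by blast
  then have "i + m * a = j + m * b" by simp
  then show ?thesis using nat_mod_eq_iff by blast
qed

lemma convex_chain:
  fixes q :: "'m::finite \<Rightarrow> nat"
  shows "convex (chain q)"
  unfolding convex_alt
proof (intro ballI allI impI)
  fix x y :: "real ^ 'm" and u :: real
  assume "x \<in> chain q" "y \<in> chain q" and u: "0 \<le> u \<and> u \<le> 1"
  then have x: "x \<in> hyperplane_H" "\<And>r s. q r \<le> q s \<Longrightarrow> x $ s \<le> x $ r \<and> x $ r \<le> x $ s + 1"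
    and y: "y \<in> hyperplane_H" "\<And>r s. q r \<le> q s \<Longrightarrow> y $ s \<le> y $ r \<and> y $ r \<le> y $ s + 1"
    by (simp_all add: chain_def)
  let ?z = "(1 - u) *\<^sub>R x + u *\<^sub>R y"
  have "?z \<in> hyperplane_H"
    using x(1) y(1) by (intro subspace_add subspace_scale subspace_hyperplane_H)
  moreover have "?z $ s \<le> ?z $ r \<and> ?z $ r \<le> ?z $ s + 1" if rs: "q r \<le> q s" for r s
  proof -
    have "(1 - u) * x $ s \<le> (1 - u) * x $ r" "u * y $ s \<le> u * y $ r"
      "(1 - u) * x $ r \<le> (1 - u) * (x $ s + 1)" "u * y $ r \<le> u * (y $ s + 1)"
      using x(2)[OF rs] y(2)[OF rs] u by (auto intro!: mult_left_mono)
    then show ?thesis by (simp add: algebra_simps)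
  qed
  ultimately show "?z \<in> chain q" by (simp add: chain_def)
qed

subsection \<open>Diamonds and simplices\<close>

text \<open>Renumberings by permutations instantiate the locale again; facts about
  \<open>chain pos\<close> thereby transfer to all its permuted copies.\<close>

locale numbering =
  fixes pos :: "'m::finite \<Rightarrow> nat" and n :: nat
  assumes bij_pos: "bij_betw pos UNIV {1..n+1}"
begin

lemma card_index: "CARD('m) = n + 1"
  using bij_betw_same_card[OF bij_pos] by simp

lemma pos_mem: "1 \<le> pos r" "pos r \<le> n + 1"
  using bij_betwE[OF bij_pos] by auto

lemma pos_eq_iff: "pos r = pos s \<longleftrightarrow> r = s"
  using bij_pos by (auto simp: bij_betw_def inj_on_def)

lemma ex_pos: "i \<in> {1..n+1} \<Longrightarrow> \<exists>r. pos r = i"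
  using bij_pos unfolding bij_betw_def by (metis imageE)

text \<open>The subtracted term does not depend on \<open>r\<close>, so differences of coordinates
  are differences of coefficients.\<close>

lemma sum_xi_component:
  assumes "finite I"
  shows "(\<Sum>i\<in>I. t i *\<^sub>R xi pos n i) $ r = of_bool (pos r \<in> I) * t (pos r) - sum t I / (real n + 1)"
proof -
  have "(\<Sum>i\<in>I. t i *\<^sub>R xi pos n i) $ r = (\<Sum>i\<in>I. t i * of_bool (pos r = i)) - sum t I / (real n + 1)"
    by (simp add: xi_def unit_vec_def right_diff_distrib sum_subtractf sum_divide_distrib)
  also have "(\<Sum>i\<in>I. t i * of_bool (pos r = i)) = of_bool (pos r \<in> I) * t (pos r)"
    using assms by (simp add: of_bool_def if_distrib[of "\<lambda>y. _ * y"] cong: if_cong)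
  finally show ?thesis .
qed

lemma xi_in_H:
  assumes "i \<in> {1..n+1}"
  shows "xi pos n i \<in> hyperplane_H"
proof -
  have "(\<Sum>r\<in>UNIV. of_bool (pos r = i) :: real) = (\<Sum>k\<in>{1..n+1}. of_bool (k = i))"
    using sum.reindex_bij_betw[OF bij_pos, of "\<lambda>k. of_bool (k = i) :: real"] .
  also have "\<dots> = 1" using assms by (simp add: of_bool_def)
  finally show ?thesis
    by (simp add: hyperplane_H_iff xi_def unit_vec_def sum_subtractf card_index add.commute)
qed

lemma sum_xi_in_H:
  assumes "I \<subseteq> {1..n+1}"
  shows "(\<Sum>i\<in>I. t i *\<^sub>R xi pos n i) \<in> hyperplane_H"
  using assms xi_in_H subspace_hyperplane_H
  by (intro subspace_sum subspace_scale) auto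

text \<open>Both sides lie in the hyperplane and differ by the same constant in every coordinate.
  The coefficient at \<open>pos J\<close> would be 0, so that index is left out.\<close>

lemma xi_expansion:
  assumes "x \<in> hyperplane_H"
  shows "x = (\<Sum>i\<in>{1..n+1} - {pos J}. (x $ inv pos i - x $ J) *\<^sub>R xi pos n i)"
proof (rule hyperplane_H_eqI)
  fix r
  have "inv pos (pos r) = r" using bij_pos by (simp add: bij_betw_def)
  then show "x $ r = (\<Sum>i\<in>{1..n+1} - {pos J}. (x $ inv pos i - x $ J) *\<^sub>R xi pos n i) $ r +
      (x $ J + (\<Sum>i\<in>{1..n+1} - {pos J}. x $ inv pos i - x $ J) / (real n + 1))"
    using pos_mem[of r] by (subst sum_xi_component) (auto simp: pos_eq_iff)
qed (use assms in \<open>auto intro!: sum_xi_in_H\<close>)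

lemma diamond_eq_cell: "diamond pos n (pos J) = cell J"
proof (intro equalityI subsetI)
  fix x assume "x \<in> diamond pos n (pos J)"
  then obtain t where t: "\<And>i. i \<in> {1..n+1} - {pos J} \<Longrightarrow> 0 \<le> t i \<and> t i \<le> 1"
    "x = (\<Sum>i\<in>{1..n+1} - {pos J}. t i *\<^sub>R xi pos n i)"
    unfolding diamond_def by blast
  have "x $ J \<le> x $ r \<and> x $ r \<le> x $ J + 1" for r
    using t(1)[of "pos r"] pos_mem[of r]
    unfolding t(2) by (subst (1 2 3 4) sum_xi_component) auto
  moreover have "x \<in> hyperplane_H" unfolding t(2) by (intro sum_xi_in_H) auto
  ultimately show "x \<in> cell J" by (simp add: cell_def)
next
  fix x assume x: "x \<in> cell J"
  have "0 \<le> x $ inv pos i - x $ J \<and> x $ inv pos i - x $ J \<le> 1" for i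
    using x by (auto simp: cell_def algebra_simps)
  moreover have "x = (\<Sum>i\<in>{1..n+1} - {pos J}. (x $ inv pos i - x $ J) *\<^sub>R xi pos n i)"
    using x by (intro xi_expansion) (simp add: cell_def)
  ultimately show "x \<in> diamond pos n (pos J)"
    unfolding diamond_def by (intro CollectI exI[of _ "\<lambda>i. x $ inv pos i - x $ J"]) simp
qed

lemma vertex_component:
  "vertex_v pos n j $ r = of_bool (pos r \<le> j) - real j / (real n + 1)"
  using sum_xi_component[of "{1..j}" "\<lambda>_. 1" r] pos_mem[of r] by (simp add: vertex_v_def)

lemma vertex_in_H: "j \<le> n \<Longrightarrow> vertex_v pos n j \<in> hyperplane_H"
  unfolding vertex_v_def by (intro subspace_sum subspace_hyperplane_H xi_in_H) auto

lemma vertex_in_chain: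
  assumes "j \<le> n"
  shows "vertex_v pos n j \<in> chain pos"
  using vertex_in_H[OF assms] by (auto simp: chain_def vertex_component of_bool_def)

lemma sigma0_eq_chain: "sigma0 pos n = chain pos"
proof (intro equalityI subsetI)
  have "sigma0 pos n \<subseteq> chain pos"
    unfolding sigma0_def using vertex_in_chain by (intro hull_minimal convex_chain) auto
  then show "x \<in> sigma0 pos n \<Longrightarrow> x \<in> chain pos" for x by blast
next
  fix x assume x: "x \<in> chain pos"
  have xH: "x \<in> hyperplane_H" using x by (simp add: chain_def)
  define y where "y i = x $ inv pos i" for i
  have y_pos: "y (pos r) = x $ r" for r using bij_pos by (simp add: y_def bij_betw_def)
  have mono: "y j \<le> y i \<and> y i \<le> y j + 1" if ij: "1 \<le> i" "i \<le> j" "j \<le> n + 1" for i j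
  proof -
    have "i \<in> {1..n+1}" "j \<in> {1..n+1}" using ij by auto
    then obtain r s where "pos r = i" "pos s = j" using ex_pos by blast
    then show ?thesis using x ij y_pos[of r] y_pos[of s] by (auto simp: chain_def)
  qed
  \<comment> \<open>Barycentric coordinates of \<open>x\<close>: successive drops of the decreasing
    coordinates, and at index 0 the slack that remains in the bound 1 on the total drop.\<close>
  define w where "w j = (if j = 0 then 1 - (y 1 - y (n + 1)) else y j - y (Suc j))" for j
  have tele: "(\<Sum>j\<in>{i..n}. w j) = y i - y (n + 1)" if "1 \<le> i" "i \<le> n + 1" for i
  proof -
    have "(\<Sum>j\<in>{i..n}. w j) = - (\<Sum>j\<in>{i..n}. y (Suc j) - y j)"
      using that unfolding sum_negf[symmetric] by (intro sum.cong) (auto simp: w_def)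
    then show ?thesis using sum_Suc_diff[of i n y] that by simp
  qed
  have nonneg: "w j \<ge> 0" if "j \<in> {0..n}" for j
    using mono[of 1 "n + 1"] mono[of j "Suc j"] that by (auto simp: w_def)
  have "(\<Sum>j\<in>{0..n}. w j) = w 0 + (\<Sum>j\<in>{1..n}. w j)"
    by (simp add: sum.atLeast_Suc_atMost)
  also have "\<dots> = 1" using tele[of 1] by (simp add: w_def)
  finally have sum1: "(\<Sum>j\<in>{0..n}. w j) = 1" .
  have "x = (\<Sum>j\<in>{0..n}. w j *\<^sub>R vertex_v pos n j)"
  proof (rule hyperplane_H_eqI[OF xH])
    show "(\<Sum>j\<in>{0..n}. w j *\<^sub>R vertex_v pos n j) \<in> hyperplane_H"
      by (intro subspace_sum subspace_scale subspace_hyperplane_H vertex_in_H) auto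
    fix r
    \<comment> \<open>Vertex \<open>j\<close> has the larger of its two values at \<open>r\<close>
      exactly when \<open>pos r \<le> j\<close>, so a tail sum appears, which telescopes.\<close>
    have "(\<Sum>j\<in>{0..n}. w j * of_bool (pos r \<le> j)) = (\<Sum>j\<in>{pos r..n}. w j)"
      by (intro sum.mono_neutral_cong_right) auto
    also have "\<dots> = x $ r - y (n + 1)" using tele[of "pos r"] pos_mem[of r] y_pos[of r] by simp
    finally show "x $ r = (\<Sum>j\<in>{0..n}. w j *\<^sub>R vertex_v pos n j) $ r +
        (y (n + 1) + (\<Sum>j\<in>{0..n}. w j * (real j / (real n + 1))))"
      by (simp add: vertex_component right_diff_distrib sum_subtractf)
  qed
  also have "\<dots> \<in> sigma0 pos n"
    unfolding sigma0_def using nonneg sum1 by (intro convex_sum convex_convex_hull) (auto intro: hull_inc)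
  finally show "x \<in> sigma0 pos n" .
qed

text \<open>At most \<open>n + 1\<close> vertices have an affine hull containing a hyperplane of
  dimension \<open>n\<close>; equality in both counts gives affine independence.\<close>

lemma simplex_sigma0: "int n simplex sigma0 pos n"
proof -
  let ?W = "vertex_v pos n ` {0..n}"
  have "hyperplane_H \<subseteq> affine hull ?W"
  proof
    fix x :: "real ^ 'm" assume x: "x \<in> hyperplane_H"
    have zero: "0 \<in> ?W" by (auto simp: image_iff vertex_v_def intro!: bexI[of _ 0])
    have xi: "xi pos n i \<in> span ?W" if "i \<in> {1..n}" for i
    proof -
      have eq: "{1..i} = insert i {1..i - 1}" using that by auto
      then have "xi pos n i = vertex_v pos n i - vertex_v pos n (i - 1)"
        unfolding vertex_v_def eq using that by (subst sum.insert) auto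
      then show ?thesis using that by (simp only:) (intro span_diff span_base imageI; auto)
    qed
    \<comment> \<open>Leaving out the last index keeps only \<open>xi\<close> at 1 to
      \<open>n\<close>, which are differences of consecutive vertices.\<close>
    obtain J where J: "pos J = n + 1" using ex_pos[of "n + 1"] by auto
    have "(\<Sum>i\<in>{1..n+1} - {pos J}. (x $ inv pos i - x $ J) *\<^sub>R xi pos n i) \<in> span ?W"
      using J by (intro span_sum span_scale xi) auto
    then show "x \<in> affine hull ?W"
      using xi_expansion[OF x, of J] affine_hull_span_0[of ?W] zero by (simp add: hull_inc)
  qed
  then have "aff_dim (hyperplane_H :: (real ^ 'm) set) \<le> aff_dim ?W"
    by (metis aff_dim_affine_hull aff_dim_subset)
  then have n: "int n \<le> aff_dim ?W" by (simp add: aff_dim_hyperplane_H card_index)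
  have "aff_dim ?W \<le> int (card ?W) - 1" by (rule aff_dim_le_card) simp
  moreover have "card ?W \<le> n + 1" using card_image_le[of "{0..n}" "vertex_v pos n"] by simp
  ultimately have "aff_dim ?W = int n" "card ?W = n + 1" using n by linarith+
  then show ?thesis
    unfolding simplex_def sigma0_def by (intro exI[of _ ?W]) (simp add: affine_independent_iff_card)
qed

lemma aff_dim_sigma0: "aff_dim (sigma0 pos n) = int n"
  using simplex_sigma0 by (rule aff_dim_simplex)

lemma polytope_sigma0: "polytope (sigma0 pos n)"
  unfolding sigma0_def polytope_def by blast

section \<open>Diamonds as hyper-rhombi\<close>

text \<open>Since \<open>xi pos n k\<close> is orthogonal to the all-ones vector, the inner product
  is just its coordinate numbered \<open>i\<close>.\<close>

lemma xi_inner: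
  assumes "i \<in> {1..n+1}" "k \<in> {1..n+1}"
  shows "xi pos n i \<bullet> xi pos n k = of_bool (i = k) - 1 / (real n + 1)"
proof -
  obtain r where r: "pos r = i" using ex_pos[OF assms(1)] by blast
  have "xi pos n i = axis r 1 - (1 / (real n + 1)) *\<^sub>R 1"
    using r by (auto simp: xi_def unit_vec_def axis_def vec_eq_iff pos_eq_iff)
  moreover have "xi pos n k \<bullet> 1 = 0" using xi_in_H[OF assms(2)] by (simp add: hyperplane_H_def)
  ultimately have "xi pos n i \<bullet> xi pos n k = xi pos n k $ r"
    by (simp add: inner_diff_left inner_axis' inner_commute[of 1])
  then show ?thesis using r by (simp add: xi_def unit_vec_def)
qed

lemma inj_on_xi: "inj_on (xi pos n) {1..n+1}"
proof (rule inj_onI)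
  fix i k assume *: "i \<in> {1..n+1}" "k \<in> {1..n+1}" "xi pos n i = xi pos n k"
  then have "xi pos n i \<bullet> xi pos n k = xi pos n i \<bullet> xi pos n i" by simp
  then show "i = k" using *(1,2) by (simp add: xi_inner split: if_splits)
qed

lemma hyper_rhombus_diamond:
  assumes "n \<ge> 2"
  shows "hyper_rhombus n (diamond pos n (pos J))"
proof -
  let ?I = "{1..n+1} - {pos J}"
  let ?B = "xi pos n ` ?I"
  have inj: "inj_on (xi pos n) ?I" using inj_on_xi by (rule inj_on_subset) auto
  have card: "card ?B = n"
    using card_image[OF inj] pos_mem[of J] by simp
  \<comment> \<open>Independence comes by counting: \<open>n\<close> vectors span a space of
    dimension \<open>n\<close>.\<close>
  have "hyperplane_H \<subseteq> span ?B"
  proof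
    fix x :: "real ^ 'm" assume "x \<in> hyperplane_H"
    from xi_expansion[OF this, of J] show "x \<in> span ?B"
      by (rule ssubst) (intro span_sum span_scale span_base, simp)
  qed
  moreover have "dim (hyperplane_H :: (real ^ 'm) set) = n"
    using aff_dim_subspace[OF subspace_hyperplane_H[where 'm = 'm]] aff_dim_hyperplane_H[where 'm = 'm]
    by (simp add: card_index)
  moreover have "?B \<subseteq> hyperplane_H" using xi_in_H by auto
  ultimately have ind: "independent ?B"
    using card by (intro eucl.card_le_dim_spanning[of _ hyperplane_H]) simp_all
  have "hyper_rhombus n (box_span 0 ?B)"
  proof (rule hyper_rhombus_box_span[OF ind card assms])
    show "b \<bullet> b = 1 - 1 / (real n + 1)" if "b \<in> ?B" for b
      using that xi_inner by auto
    show "b \<bullet> c = - 1 / (real n + 1)" if "b \<in> ?B" "c \<in> ?B" "b \<noteq> c" for b c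
      using that xi_inner by auto
  qed
  then show ?thesis unfolding box_span_image[OF inj] diamond_def by (simp only: add_0_left)
qed

section \<open>Dimensions of the pieces\<close>

lemma chain_subset_cell:
  assumes "pos J = n + 1"
  shows "chain pos \<subseteq> cell J"
  using assms pos_mem by (auto simp: chain_def cell_def)

lemma numbering_permute: "\<pi> permutes {1..n+1} \<Longrightarrow> numbering (\<pi> \<circ> pos) n"
  using bij_betw_trans[OF bij_pos permutes_imp_bij] by unfold_locales

lemma aff_dim_voronoi_cell_0_le: "aff_dim (voronoi_cell_0 :: (real ^ 'm) set) \<le> int n"
proof -
  have "aff_dim (voronoi_cell_0 :: (real ^ 'm) set) \<le> aff_dim (hyperplane_H :: (real ^ 'm) set)"
    by (rule aff_dim_subset) (auto simp: voronoi_cell_0_def)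
  then show ?thesis by (simp add: aff_dim_hyperplane_H card_index)
qed

lemma aff_dim_cell: "aff_dim (cell (J :: 'm)) = int n"
proof -
  \<comment> \<open>Renumbering makes \<open>J\<close> the last coordinate, so that
    \<open>cell J\<close> contains an \<open>n\<close>-dimensional simplex.\<close>
  have "Transposition.transpose (pos J) (n + 1) permutes {1..n+1}"
    using pos_mem[of J] by (intro permutes_swap_id) auto
  then interpret q: numbering "Transposition.transpose (pos J) (n + 1) \<circ> pos" n
    by (rule numbering_permute)
  have "int n \<le> aff_dim (cell J)"
    using aff_dim_subset[OF q.chain_subset_cell[of J]] q.aff_dim_sigma0 q.sigma0_eq_chain by simp
  moreover have "aff_dim (cell J) \<le> aff_dim (voronoi_cell_0 :: (real ^ 'm) set)"
    by (rule aff_dim_subset) (auto simp: voronoi_cell_0_eq_Union_cell)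
  ultimately show ?thesis using aff_dim_voronoi_cell_0_le by simp
qed

lemma aff_dim_voronoi_cell_0: "aff_dim (voronoi_cell_0 :: (real ^ 'm) set) = int n"
proof -
  have "cell (undefined :: 'm) \<subseteq> voronoi_cell_0" by (auto simp: voronoi_cell_0_eq_Union_cell)
  from aff_dim_subset[OF this] show ?thesis using aff_dim_voronoi_cell_0_le by (simp add: aff_dim_cell)
qed

lemma disjoint_union_of_cells: "disjoint_union_of UNIV cell (voronoi_cell_0 :: (real ^ 'm) set)"
  unfolding disjoint_union_of_def
proof (intro conjI ballI impI)
  show "voronoi_cell_0 = (\<Union>J :: 'm. cell J)" by (rule voronoi_cell_0_eq_Union_cell)
qed (simp_all add: polytope_cell disjoint_rel_interior_cells aff_dim_cell aff_dim_voronoi_cell_0)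

lemma disjoint_union_of_diamonds: "disjoint_union_of {1..n+1} (diamond pos n) voronoi_cell_0"
  using disjoint_union_of_cells
proof (rule disjoint_union_of_reindex)
  show "range pos = {1..n+1}" using bij_pos by (simp add: bij_betw_def)
qed (simp add: diamond_eq_cell)

section \<open>Disjointness of the simplices\<close>

lemma ex_reversed_pair:
  assumes "numbering q n" "q \<noteq> pos"
  shows "\<exists>r s. pos r < pos s \<and> q s < q r"
proof (rule ccontr)
  interpret q: numbering q n by fact
  assume *: "\<nexists>r s. pos r < pos s \<and> q s < q r"
  have less: "q r < q s" if "pos r < pos s" for r s
    using * that q.pos_eq_iff[of r s] by (metis less_irrefl linorder_neqE_nat)
  have le: "q r \<le> q s \<longleftrightarrow> pos r \<le> pos s" for r s
    using less[of r s] less[of s r] pos_eq_iff[of r s] by (metis le_less linorder_not_less)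
  \<comment> \<open>A numbering is recovered from its order by counting ranks; without a reversed
    pair the two orders, hence the numberings, coincide.\<close>
  have count: "card {t. p t \<le> p r} = p r" if "numbering p n" for p :: "'m \<Rightarrow> nat" and r
  proof -
    interpret p: numbering p n by fact
    have "p ` {t. p t \<le> p r} = {1..p r}"
    proof (intro equalityI subsetI)
      fix i assume i: "i \<in> {1..p r}"
      then obtain t where "p t = i" using p.ex_pos[of i] p.pos_mem(2)[of r] by auto
      then show "i \<in> p ` {t. p t \<le> p r}" using i by auto
    qed (use p.pos_mem in auto)
    moreover have "inj_on p {t. p t \<le> p r}" by (rule inj_onI) (simp add: p.pos_eq_iff)
    ultimately show ?thesis by (metis card_image card_atLeastAtMost diff_Suc_1)
  qed
  have "q r = pos r" for r
    using count[OF assms(1), of r] count[OF numbering_axioms, of r] by (simp add: le)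
  then show False using assms(2) by auto
qed

lemma disjoint_rel_interior_chains:
  assumes "numbering q n" "q \<noteq> pos"
  shows "rel_interior (chain pos) \<inter> rel_interior (chain q) = {}"
proof -
  obtain r s where rs: "pos r < pos s" "q s < q r" using ex_reversed_pair[OF assms] by blast
  have n: "pos r \<le> n" using rs(1) pos_mem(2)[of s] by simp
  show ?thesis
  \<comment> \<open>The two numberings order \<open>r\<close> and \<open>s\<close> oppositely. The
    chosen vertex drops by 1 right after position \<open>pos r\<close>, so it tells \<open>r\<close>
    from \<open>s\<close>.\<close>
  proof (rule disjoint_rel_interior_separated[where f = "\<lambda>x. x $ r - x $ s" and w = "vertex_v pos n (pos r)"])
    show "vertex_v pos n (pos r) \<in> chain pos" using n by (rule vertex_in_chain)
    show "vertex_v pos n (pos r) $ r - vertex_v pos n (pos r) $ s \<noteq> 0"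
      using rs(1) by (simp add: vertex_component)
    show "linear (\<lambda>x :: real ^ 'm. x $ r - x $ s)" by (rule linearI) (simp_all add: algebra_simps)
  qed (use rs in \<open>simp_all add: convex_chain, simp_all add: chain_def\<close>)
qed

section \<open>Matrices as permutations of coordinates\<close>

text \<open>Lifts an injection of numbers to a bijection of coordinates. It is used with the
  identity \<phi> to compare two numberings, and with \<open>q = pos\<close> to interpret
  matrices.\<close>

lemma ex_index_bij:
  fixes q :: "'m \<Rightarrow> nat"
  assumes "numbering q n" "\<phi> ` {1..n+1} \<subseteq> {1..n+1}" "inj_on \<phi> {1..n+1}"
  shows "\<exists>\<tau>. bij \<tau> \<and> (\<forall>c. q (\<tau> c) = \<phi> (pos c))"
proof -
  interpret q: numbering q n by fact
  have pos: "pos c \<in> {1..n+1}" for c using pos_mem by simp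
  then have "\<exists>r. q r = \<phi> (pos c)" for c
    using assms(2) by (intro q.ex_pos) blast
  then obtain \<tau> where \<tau>: "\<And>c. q (\<tau> c) = \<phi> (pos c)" by metis
  have inj: "inj \<tau>"
  proof (rule injI)
    fix c d assume "\<tau> c = \<tau> d"
    then have "\<phi> (pos c) = \<phi> (pos d)" using \<tau>[of c] \<tau>[of d] by simp
    then have "pos c = pos d" by (rule inj_onD[OF assms(3) _ pos pos])
    then show "c = d" by (simp add: pos_eq_iff)
  qed
  then have "bij \<tau>" by (rule bijI) (rule finite_UNIV_inj_surj[OF finite_class.finite_UNIV inj])
  then show ?thesis using \<tau> by blast
qed

lemma congruent_sets_chain:
  assumes "numbering q n"
  shows "congruent_sets (chain pos) (chain q)"
proof -
  obtain \<tau> where \<tau>: "bij \<tau>" "\<And>c. q (\<tau> c) = pos c"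
    using ex_index_bij[OF assms, of "\<lambda>i. i"] by auto
  have "pos \<circ> inv \<tau> = q"
    using \<tau>(2)[of "inv \<tau> _"] surj_f_inv_f[OF bij_is_surj[OF \<tau>(1)]] by (simp add: fun_eq_iff)
  then show ?thesis
    using congruent_sets_permute_coords[OF \<tau>(1), of "chain pos"] permute_coords_chain[OF \<tau>(1), of pos] by simp
qed

text \<open>The matrix permutes coordinates by \<pi> with \<open>n + 1\<close> kept fixed. The value
  arriving at position \<open>i\<close> comes from position \<open>inv \<pi> i\<close>, hence the
  inverse.\<close>

lemma block_matrix_chain:
  assumes "\<pi> permutes {1..n}"
  shows "(*v) (block_matrix pos n (\<lambda>i j. of_bool (i = \<pi> j))) ` chain pos = chain (inv \<pi> \<circ> pos)"
proof -
  have p: "\<pi> permutes {1..n+1}" using assms by (rule permutes_subset) auto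
  obtain \<tau> where \<tau>: "bij \<tau>" "\<And>c. pos (\<tau> c) = \<pi> (pos c)"
    using ex_index_bij[OF numbering_axioms, of \<pi>] permutes_image[OF p] permutes_inj_on[OF p] by blast
  have "(if pos r \<le> n \<and> pos c \<le> n then of_bool (pos r = \<pi> (pos c)) else of_bool (pos r = pos c)) =
      (of_bool (r = \<tau> c) :: real)" for r c
  proof -
    have "r = \<tau> c \<longleftrightarrow> pos r = \<pi> (pos c)" using \<tau>(2)[of c] pos_eq_iff[of r "\<tau> c"] by simp
    moreover have "\<pi> (pos c) \<in> {1..n}" if "pos c \<le> n"
      using that pos_mem[of c] permutes_in_image[OF assms, of "pos c"] by simp
    moreover have "\<pi> (pos c) = pos c" if "\<not> pos c \<le> n"
      using that permutes_not_in[OF assms, of "pos c"] by simp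
    ultimately show ?thesis by (cases "pos c \<le> n") auto
  qed
  then have "(*v) (block_matrix pos n (\<lambda>i j. of_bool (i = \<pi> j))) = permute_coords \<tau>"
    unfolding block_matrix_def by (simp add: matrix_permute_coords[OF \<tau>(1)] fun_eq_iff)
  moreover have "pos \<circ> inv \<tau> = inv \<pi> \<circ> pos"
  proof
    fix r
    have "pos r = \<pi> (pos (inv \<tau> r))"
      using \<tau> by (metis bij_is_surj surj_f_inv_f)
    then show "(pos \<circ> inv \<tau>) r = (inv \<pi> \<circ> pos) r"
      using permutes_inverses(2)[OF p] by simp
  qed
  ultimately show ?thesis using permute_coords_chain[OF \<tau>(1), of pos] by simp
qed

lemma numbering_inv_permute: "\<pi> permutes {1..n} \<Longrightarrow> numbering (inv \<pi> \<circ> pos) n"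
  by (rule numbering_permute[OF permutes_inv[OF permutes_subset]]) auto

section \<open>Simplices in a diamond\<close>

lemma disjoint_union_of_chains:
  assumes J: "pos J = n + 1"
  shows "disjoint_union_of {\<pi>. \<pi> permutes {1..n}} (\<lambda>\<pi>. chain (inv \<pi> \<circ> pos)) (cell J)"
  unfolding disjoint_union_of_def
proof (intro conjI ballI impI; (elim CollectE)?)
  fix \<pi> assume p: "\<pi> permutes {1..n}"
  interpret q: numbering "inv \<pi> \<circ> pos" n using p by (rule numbering_inv_permute)
  show "polytope (chain (inv \<pi> \<circ> pos))" using q.polytope_sigma0 q.sigma0_eq_chain by simp
  show "aff_dim (chain (inv \<pi> \<circ> pos)) = aff_dim (cell J)"
    using q.aff_dim_sigma0 q.sigma0_eq_chain by (simp add: aff_dim_cell)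
  fix \<rho> assume r: "\<rho> permutes {1..n}" and ne: "\<pi> \<noteq> \<rho>"
  have "inv \<rho> \<circ> pos \<noteq> inv \<pi> \<circ> pos"
  proof
    assume eq: "inv \<rho> \<circ> pos = inv \<pi> \<circ> pos"
    have "inv \<rho> i = inv \<pi> i" for i
    proof (cases "i \<in> {1..n}")
      case True
      then obtain c where "pos c = i" using ex_pos[of i] by auto
      then show ?thesis using fun_cong[OF eq, of c] by simp
    next
      case False
      then show ?thesis
        using permutes_not_in[OF permutes_inv[OF p]] permutes_not_in[OF permutes_inv[OF r]] by simp
    qed
    then have "inv (inv \<rho>) = inv (inv \<pi>)" by presburger
    then show False using ne p r by (simp add: permutes_inv_inv)
  qed
  then show "rel_interior (chain (inv \<pi> \<circ> pos)) \<inter> rel_interior (chain (inv \<rho> \<circ> pos)) = {}"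
    using q.disjoint_rel_interior_chains numbering_inv_permute[OF r] by blast
next
  show "cell J = (\<Union>\<pi>\<in>{\<pi>. \<pi> permutes {1..n}}. chain (inv \<pi> \<circ> pos))"
  proof (intro equalityI subsetI)
    fix x assume x: "x \<in> cell J"
    \<comment> \<open>Only the first \<open>n\<close> positions are sorted: on \<open>cell J\<close>
      the last one already carries a smallest coordinate.\<close>
    obtain g where g: "bij_betw g {1..n} {1..n}"
      "\<And>i j. i \<in> {1..n} \<Longrightarrow> j \<in> {1..n} \<Longrightarrow> i \<le> j \<Longrightarrow> x $ inv pos (g j) \<le> x $ inv pos (g i)"
      using antitone_enumeration[of "{1..n}" "\<lambda>i. x $ inv pos i"] by auto
    define \<pi> where "\<pi> i = (if i \<in> {1..n} then g i else i)" for i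
    have "bij_betw \<pi> {1..n} {1..n}"
      using g(1) by (rule bij_betw_cong[THEN iffD1, rotated]) (simp add: \<pi>_def)
    then have p: "\<pi> permutes {1..n}" by (rule bij_imp_permutes) (simp only: \<pi>_def if_False)
    have inv_pos: "inv pos (pos r) = r" for r using bij_pos by (simp add: bij_betw_def)
    have "x $ s \<le> x $ r" if rs: "inv \<pi> (pos r) \<le> inv \<pi> (pos s)" for r s
    proof (cases "s = J")
      case True
      then show ?thesis using x by (simp add: cell_def)
    next
      case False
      have J_fix: "inv \<pi> (n + 1) = n + 1" using permutes_not_in[OF permutes_inv[OF p], of "n + 1"] by simp
      have s: "pos s \<in> {1..n}" using False pos_mem[of s] pos_eq_iff[of s J] J by auto
      then have sn: "inv \<pi> (pos s) \<in> {1..n}" using permutes_in_image[OF permutes_inv[OF p]] by blast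
      then have "r \<noteq> J" using rs J J_fix by auto
      then have "pos r \<in> {1..n}" using pos_mem[of r] pos_eq_iff[of r J] J by auto
      then have rn: "inv \<pi> (pos r) \<in> {1..n}" using permutes_in_image[OF permutes_inv[OF p]] by blast
      have "g (inv \<pi> (pos t)) = pos t" if "inv \<pi> (pos t) \<in> {1..n}" for t
        using permutes_inverses(1)[OF p, of "pos t"] that unfolding \<pi>_def by presburger
      then show ?thesis using g(2)[OF rn sn rs] rn sn by (simp add: inv_pos)
    qed
    moreover have "x $ r \<le> x $ s + 1" for r s
      using x by (simp add: cell_def) (smt (verit))
    ultimately have "x \<in> chain (inv \<pi> \<circ> pos)" using x by (simp add: chain_def cell_def)
    then show "x \<in> (\<Union>\<pi>\<in>{\<pi>. \<pi> permutes {1..n}}. chain (inv \<pi> \<circ> pos))" using p by blast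
  next
    fix x assume "x \<in> (\<Union>\<pi>\<in>{\<pi>. \<pi> permutes {1..n}}. chain (inv \<pi> \<circ> pos))"
    then obtain \<pi> where p: "\<pi> permutes {1..n}" "x \<in> chain (inv \<pi> \<circ> pos)" by blast
    interpret q: numbering "inv \<pi> \<circ> pos" n using p(1) by (rule numbering_inv_permute)
    have "(inv \<pi> \<circ> pos) J = n + 1"
      using permutes_not_in[OF permutes_inv[OF p(1)], of "n + 1"] J by simp
    then show "x \<in> cell J" using q.chain_subset_cell p(2) by blast
  qed
qed

lemma composed_of_chains:
  assumes "pos J = n + 1"
  shows "composed_of_congruent (fact n) ((\<lambda>\<pi>. chain (inv \<pi> \<circ> pos)) ` {\<pi>. \<pi> permutes {1..n}}) (cell J)"
proof -
  have "card {\<pi>. \<pi> permutes {1..n}} = fact n" by (rule card_permutations) auto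
  moreover have "composed_of_congruent (card {\<pi>. \<pi> permutes {1..n}})
      ((\<lambda>\<pi>. chain (inv \<pi> \<circ> pos)) ` {\<pi>. \<pi> permutes {1..n}}) (cell J)"
    using disjoint_union_of_chains[OF assms]
  proof (rule composed_of_congruent_image)
    show "finite {\<pi>. \<pi> permutes {1..n}}" by (rule finite_permutations) simp
    show "aff_dim (cell J) \<ge> 0" by (simp add: aff_dim_cell)
    show "congruent_sets (chain (inv \<pi> \<circ> pos)) (chain (inv \<rho> \<circ> pos))"
      if "\<pi> \<in> {\<pi>. \<pi> permutes {1..n}}" "\<rho> \<in> {\<pi>. \<pi> permutes {1..n}}" for \<pi> \<rho>
      using numbering.congruent_sets_chain[OF numbering_inv_permute numbering_inv_permute] that by blast
  qed
  ultimately show ?thesis by (simp only:)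
qed

lemma simplex_chain: "int n simplex chain pos"
  using simplex_sigma0 sigma0_eq_chain by simp

text \<open>The cell does not depend on the numbering, so one in which \<open>J\<close> comes last
  may be used.\<close>

lemma ex_simplex_decomposition:
  "\<exists>\<T>. composed_of_congruent (fact n) \<T> (cell (J :: 'm)) \<and> (\<forall>T\<in>\<T>. int n simplex T)"
proof -
  have "Transposition.transpose (pos J) (n + 1) permutes {1..n+1}"
    using pos_mem[of J] by (intro permutes_swap_id) auto
  then interpret q: numbering "Transposition.transpose (pos J) (n + 1) \<circ> pos" n
    by (rule numbering_permute)
  show ?thesis
  proof (intro exI conjI)
    show "composed_of_congruent (fact n) ((\<lambda>\<pi>. chain (inv \<pi> \<circ> (Transposition.transpose (pos J) (n + 1) \<circ> pos))) `
        {\<pi>. \<pi> permutes {1..n}}) (cell J)"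
      by (rule q.composed_of_chains) simp
  qed (use numbering.simplex_chain[OF q.numbering_inv_permute] in blast)
qed

section \<open>Circular shifts\<close>

lemma circ_shift_permute_coords:
  "\<exists>\<tau>. bij \<tau> \<and> (*v) (circ_shift pos (n + 1) k) = permute_coords \<tau> \<and>
    (\<forall>c. pos (\<tau> c) mod (n + 1) = (pos c + k) mod (n + 1))"
proof -
  let ?m = "n + 1"
  \<comment> \<open>The representative of \<open>i + k\<close> in the range from 1 to
    \<open>n + 1\<close>, where residue 0 is written as \<open>n + 1\<close>.\<close>
  define \<phi> where "\<phi> i = (if (i + k) mod ?m = 0 then ?m else (i + k) mod ?m)" for i
  have \<phi>: "\<phi> i mod ?m = (i + k) mod ?m" "\<phi> i \<in> {1..?m}" for i
    using mod_less_divisor[of ?m "i + k"] by (auto simp: \<phi>_def)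
  have "inj_on \<phi> {1..?m}"
  proof (rule inj_onI)
    fix i j assume ij: "i \<in> {1..?m}" "j \<in> {1..?m}" "\<phi> i = \<phi> j"
    then have "(i + k) mod ?m = (j + k) mod ?m" using \<phi>(1) by metis
    then have "i mod ?m = j mod ?m" by (rule mod_add_right_cancel_nat)
    then show "i = j" by (rule mod_eq_imp_eq[OF ij(1,2)])
  qed
  then obtain \<tau> where \<tau>: "bij \<tau>" "\<And>c. pos (\<tau> c) = \<phi> (pos c)"
    using ex_index_bij[OF numbering_axioms, of \<phi>] \<phi>(2) by blast
  have mod: "pos (\<tau> c) mod ?m = (pos c + k) mod ?m" for c using \<tau>(2) \<phi>(1) by simp
  have "pos r mod ?m = (pos c + k) mod ?m \<longleftrightarrow> r = \<tau> c" for r c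
    using mod_eq_imp_eq[of "pos r" ?m "pos (\<tau> c)"] pos_mem[of r] pos_mem[of "\<tau> c"] mod[of c]
    by (metis atLeastAtMost_iff pos_eq_iff)
  then have "(*v) (circ_shift pos ?m k) = permute_coords \<tau>"
    unfolding circ_shift_def by (simp add: matrix_permute_coords[OF \<tau>(1)] fun_eq_iff)
  then show ?thesis using \<tau>(1) mod by blast
qed

text \<open>Position \<open>n + 1\<close> counts as 0 modulo \<open>n + 1\<close>, so the shift
  moves the omitted index \<open>n + 1\<close> to \<open>j\<close>.\<close>

lemma diamond_eq_circ_shift:
  assumes "j \<in> {1..n+1}"
  shows "diamond pos n j = (*v) (circ_shift pos (n + 1) (j mod (n + 1))) ` diamond pos n (n + 1)"
proof -
  obtain J where J: "pos J = n + 1" using ex_pos[of "n + 1"] by auto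
  obtain \<tau> where \<tau>: "bij \<tau>" "(*v) (circ_shift pos (n + 1) (j mod (n + 1))) = permute_coords \<tau>"
    "pos (\<tau> J) mod (n + 1) = (pos J + j mod (n + 1)) mod (n + 1)"
    using circ_shift_permute_coords[of "j mod (n + 1)"] by blast
  have "pos (\<tau> J) \<in> {1..n+1}" using pos_mem by simp
  moreover note assms
  moreover have "pos (\<tau> J) mod (n + 1) = j mod (n + 1)" using \<tau>(3) unfolding J by (metis mod_add_self1 mod_mod_trivial)
  ultimately have "pos (\<tau> J) = j" by (rule mod_eq_imp_eq)
  then show ?thesis
    using diamond_eq_cell[of J] diamond_eq_cell[of "\<tau> J"] J \<tau>(2) permute_coords_cell[OF \<tau>(1), of J] by simp
qed

lemma disjoint_union_of_circ_shifts:
  "disjoint_union_of (circ_shifts pos (n + 1)) (\<lambda>\<Gamma>. (*v) \<Gamma> ` diamond pos n (n + 1)) voronoi_cell_0"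
  using disjoint_union_of_diamonds
proof (rule disjoint_union_of_reindex)
  \<comment> \<open>The shift amounts 0 to \<open>n\<close> are the residues of 1 to
    \<open>n + 1\<close>, with \<open>n + 1\<close> supplying 0.\<close>
  have "(\<lambda>j. j mod (n + 1)) ` {1..n+1} = {0..<n+1}"
  proof (intro equalityI subsetI)
    fix k assume k: "k \<in> {0..<n+1}"
    show "k \<in> (\<lambda>j. j mod (n + 1)) ` {1..n+1}"
    proof (cases "k = 0")
      case True
      then show ?thesis by (intro image_eqI[of _ _ "n + 1"]) auto
    next
      case False
      then show ?thesis using k by (intro image_eqI[of _ _ k]) auto
    qed
  qed auto
  then show "(\<lambda>j. circ_shift pos (n + 1) (j mod (n + 1))) ` {1..n+1} = circ_shifts pos (n + 1)"
    unfolding circ_shifts_def by (metis image_image)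
qed (rule diamond_eq_circ_shift[symmetric])

lemma G1_eq: "G1 pos n = (\<lambda>\<pi>. block_matrix pos n (\<lambda>i j. of_bool (i = \<pi> j))) ` {\<pi>. \<pi> permutes {1..n}}"
  unfolding G1_def perm_matrices_def by (auto simp: image_iff)

end

theorem lemma5:
  fixes n :: nat and pos :: "'m::finite \<Rightarrow> nat"
  assumes "n \<ge> 2" and "bij_betw pos UNIV {1..n+1}"
  shows
    "composed_of_congruent (n + 1) (diamond pos n ` {1..n+1}) (voronoi_cell_0 :: (real ^ 'm) set) \<and>
     (\<forall>j\<in>{1..n+1}. hyper_rhombus n (diamond pos n j)) \<and>
     (\<forall>j\<in>{1..n+1}. \<exists>\<T>. composed_of_congruent (fact n) \<T> (diamond pos n j) \<and>
        (\<forall>T\<in>\<T>. int n simplex T)) \<and>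
     composed_of_congruent (fact n) ((\<lambda>Q. (*v) Q ` sigma0 pos n) ` G1 pos n) (diamond pos n (n + 1)) \<and>
     (\<forall>Q\<in>G1 pos n. int n simplex ((*v) Q ` sigma0 pos n)) \<and>
     disjoint_union_of (G1 pos n) (\<lambda>Q. (*v) Q ` sigma0 pos n) (diamond pos n (n + 1)) \<and>
     disjoint_union_of (circ_shifts pos (n + 1)) (\<lambda>\<Gamma>. (*v) \<Gamma> ` diamond pos n (n + 1)) voronoi_cell_0 \<and>
     disjoint_union_of {1..n+1} (diamond pos n) voronoi_cell_0 \<and>
     (\<forall>j\<in>{1..n+1}. diamond pos n j =
        (*v) (circ_shift pos (n + 1) (j mod (n + 1))) ` diamond pos n (n + 1))"
proof -
  interpret numbering pos n using assms(2) by unfold_locales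
  obtain J where J: "pos J = n + 1" using ex_pos[of "n + 1"] by auto
  have cell: "diamond pos n (n + 1) = cell J" using diamond_eq_cell[of J] J by simp
  have image: "(*v) (block_matrix pos n (\<lambda>i j. of_bool (i = \<pi> j))) ` sigma0 pos n = chain (inv \<pi> \<circ> pos)"
    if "\<pi> permutes {1..n}" for \<pi>
    using block_matrix_chain[OF that] by (simp add: sigma0_eq_chain)
  have images: "(\<lambda>Q. (*v) Q ` sigma0 pos n) ` G1 pos n = (\<lambda>\<pi>. chain (inv \<pi> \<circ> pos)) ` {\<pi>. \<pi> permutes {1..n}}"
    unfolding G1_eq image_image by (rule image_cong) (simp_all add: image)
  have "congruent_sets (diamond pos n i) (diamond pos n j)" if ij: "i \<in> {1..n+1}" "j \<in> {1..n+1}" for i j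
  proof -
    obtain I K where "pos I = i" "pos K = j" using ij ex_pos by blast
    then show ?thesis using congruent_sets_cell[of I K] diamond_eq_cell by metis
  qed
  then have diamonds: "composed_of_congruent (n + 1) (diamond pos n ` {1..n+1}) voronoi_cell_0"
    using composed_of_congruent_image[OF disjoint_union_of_diamonds] by (simp add: aff_dim_voronoi_cell_0)
  show ?thesis
  proof (intro conjI ballI)
    show "composed_of_congruent (n + 1) (diamond pos n ` {1..n+1}) (voronoi_cell_0 :: (real ^ 'm) set)"
      by (rule diamonds)
    show "composed_of_congruent (fact n) ((\<lambda>Q. (*v) Q ` sigma0 pos n) ` G1 pos n) (diamond pos n (n + 1))"
      unfolding images cell using J by (rule composed_of_chains)
    show "disjoint_union_of (G1 pos n) (\<lambda>Q. (*v) Q ` sigma0 pos n) (diamond pos n (n + 1))"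
      \<comment> \<open>The index set changes from permutations to their block matrices.\<close>
      unfolding cell using disjoint_union_of_chains[OF J] G1_eq[symmetric]
      by (rule disjoint_union_of_reindex) (simp add: image)
    show "int n simplex ((*v) Q ` sigma0 pos n)" if "Q \<in> G1 pos n" for Q
      using that numbering.simplex_chain[OF numbering_inv_permute] image unfolding G1_eq by auto
    fix j assume j: "j \<in> {1..n+1}"
    then obtain K where K: "pos K = j" using ex_pos by blast
    show "hyper_rhombus n (diamond pos n j)" using hyper_rhombus_diamond[OF assms(1), of K] K by simp
    show "\<exists>\<T>. composed_of_congruent (fact n) \<T> (diamond pos n j) \<and> (\<forall>T\<in>\<T>. int n simplex T)"
      using ex_simplex_decomposition[of K] diamond_eq_cell[of K] K by simp
    show "diamond pos n j = (*v) (circ_shift pos (n + 1) (j mod (n + 1))) ` diamond pos n (n + 1)"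
      using j by (rule diamond_eq_circ_shift)
  qed (rule disjoint_union_of_circ_shifts disjoint_union_of_diamonds)+
qed

end
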